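(* Let $r\ge 2$, let $s_1,\ldots,s_{r-1},t$ be positive integers, and set $s=\prod_{i=1}^{r-1}s_i$. Suppose $2\le s\le t$. There exist constants $c,C>0$, depending only on $r,s_1,\ldots,s_{r-1},t$, such that for all positive integers $m_1,\ldots,m_{r-1},n$ with $m_i\ge n$ for all $1\le i\le r-1$ and for which $m=\prod_{i=1}^{r-1}m_i$ satisfies $$m\ \le\ n^{\,t^{1/(s-1)}/(s(s-1))},$$ we have $$c\, m_1\cdots m_{r-1}\, n^{\,1-\frac{1}{s_1s_2\cdots s_{r-1}}}\ \le\ z(m_1,\ldots,m_{r-1},n;s_1,\ldots,s_{r-1},t)\ \le\ C\, m_1\cdots m_{r-1}\, n^{\,1-\frac{1}{s_1s_2\cdots s_{r-1}}}.$$
   Context: An $r$-graph $H$ is a pair $(V(H),E(H))$ where $E(H)$ is a collection of $r$-element subsets of the finite set $V(H)$. It is $r$-partite with parts $V_1,\ldots,V_r$ if $V(H)$ is the disjoint union of the $V_i$ and every edge contains exactly one vertex of each $V_i$. $K_{s_1,\ldots,s_r}$ denotes the complete $r$-partite $r$-graph whose $i$-th part has $s_i$ vertices. $H$ contains an ordered $K_{s_1,\ldots,s_r}$ if there are sets $S_i\subseteq V_i$ with $|S_i|=s_i$ for $1\le i\le r$ such that $\{v_1,\ldots,v_r\}\in E(H)$ for all choices $v_i\in S_i$. The Zarankiewicz number $z(m_1,\ldots,m_r;s_1,\ldots,s_r)$ is the maximum number of edges of an $r$-partite $r$-graph whose $i$-th part has $m_i$ vertices ($1\le i\le r$) and which does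 not contain an ordered $K_{s_1,\ldots,s_r}$. In the claim this is used with $m_r=n$ and $s_r=t$. *)

theory Defs
  imports "HOL-Analysis.Analysis"
begin

text \<open>A hypergraph is a pair (vertex set, edge set). Parts and part sizes are indexed by
  \<open>{1..r}\<close>; values of the indexing functions outside that range are irrelevant.\<close>

type_synonym 'a hypergraph = "'a set \<times> 'a set set"

abbreviation verts :: "'a hypergraph \<Rightarrow> 'a set" where "verts H \<equiv> fst H"
abbreviation edges :: "'a hypergraph \<Rightarrow> 'a set set" where "edges H \<equiv> snd H"

definition rgraph :: "nat \<Rightarrow> 'a hypergraph \<Rightarrow> bool" where
  "rgraph r H \<longleftrightarrow> finite (verts H) \<and> (\<forall>e\<in>edges H. e \<subseteq> verts H \<and> card e = r)"

definition rpartite :: "nat \<Rightarrow> (nat \<Rightarrow> 'a set) \<Rightarrow> 'a hypergraph \<Rightarrow> bool" where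
  "rpartite r V H \<longleftrightarrow>
     verts H = (\<Union>i\<in>{1..r}. V i) \<and> disjoint_family_on V {1..r} \<and>
     (\<forall>e\<in>edges H. \<forall>i\<in>{1..r}. card (e \<inter> V i) = 1)"

definition contains_ordered_K ::
    "nat \<Rightarrow> (nat \<Rightarrow> nat) \<Rightarrow> (nat \<Rightarrow> 'a set) \<Rightarrow> 'a hypergraph \<Rightarrow> bool" where
  "contains_ordered_K r s V H \<longleftrightarrow>
     (\<exists>S. (\<forall>i\<in>{1..r}. S i \<subseteq> V i \<and> card (S i) = s i) \<and>
          (\<forall>v. (\<forall>i\<in>{1..r}. v i \<in> S i) \<longrightarrow> v ` {1..r} \<in> edges H))"

definition zarankiewicz_admissible ::
    "nat \<Rightarrow> (nat \<Rightarrow> nat) \<Rightarrow> (nat \<Rightarrow> nat) \<Rightarrow> (nat \<Rightarrow> 'a set) \<Rightarrow> 'a hypergraph \<Rightarrow> bool" where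
  "zarankiewicz_admissible r m s V H \<longleftrightarrow>
     rgraph r H \<and> rpartite r V H \<and> (\<forall>i\<in>{1..r}. card (V i) = m i) \<and>
     \<not> contains_ordered_K r s V H"

text \<open>Vertices are taken to be natural numbers. Since vertex sets are finite this loses no
  generality, and the maximum is over a finite set that is nonempty as soon as all \<open>s i\<close>
  with \<open>i \<in> {1..r}\<close> are positive; see the lemmas below.\<close>

definition zarankiewicz :: "nat \<Rightarrow> (nat \<Rightarrow> nat) \<Rightarrow> (nat \<Rightarrow> nat) \<Rightarrow> nat" where
  "zarankiewicz r m s =
     Max {card (edges H) |(V :: nat \<Rightarrow> nat set) H. zarankiewicz_admissible r m s V H}"

lemma finite_zarankiewicz_set:
  "finite {card (edges H) |(V :: nat \<Rightarrow> 'a set) H. zarankiewicz_admissible r m s V H}"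
proof -
  have "card (edges H) \<le> 2 ^ (\<Sum>i\<in>{1..r}. m i)"
    if A: "zarankiewicz_admissible r m s V H" for V :: "nat \<Rightarrow> 'a set" and H
  proof -
    have fin: "finite (verts H)" and sub: "edges H \<subseteq> Pow (verts H)"
      and U: "verts H = (\<Union>i\<in>{1..r}. V i)"
      and c: "\<And>i. i \<in> {1..r} \<Longrightarrow> card (V i) = m i"
      using A by (auto simp: zarankiewicz_admissible_def rgraph_def rpartite_def)
    have "card (verts H) \<le> (\<Sum>i\<in>{1..r}. card (V i))"
      unfolding U by (rule card_UN_le) simp
    also have "\<dots> = (\<Sum>i\<in>{1..r}. m i)" by (rule sum.cong) (auto simp: c)
    finally have "(2::nat) ^ card (verts H) \<le> 2 ^ (\<Sum>i\<in>{1..r}. m i)"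
      by (rule power_increasing) simp
    moreover have "card (edges H) \<le> 2 ^ card (verts H)"
      using card_mono[OF _ sub] fin by (simp add: card_Pow)
    ultimately show ?thesis by (rule le_trans[rotated])
  qed
  then show ?thesis by (intro finite_subset[OF _ finite_atMost]) blast
qed

lemma zarankiewicz_attained:
  assumes "\<forall>i\<in>{1..r}. 0 < s i"
  obtains V :: "nat \<Rightarrow> nat set" and H
  where "zarankiewicz_admissible r m s V H" "card (edges H) = zarankiewicz r m s"
proof -
  define V :: "nat \<Rightarrow> nat set" where "V = (\<lambda>i. (\<lambda>j. prod_encode (i, j)) ` {..<m i})"
  have "disjoint_family_on V {1..r}"
    by (auto simp: disjoint_family_on_def V_def)
  moreover have "card (V i) = m i" for i
    unfolding V_def by (subst card_image) (auto simp: inj_on_def)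
  moreover have "finite (\<Union>i\<in>{1..r}. V i)" by (auto simp: V_def)
  moreover have "\<not> contains_ordered_K r s V ((\<Union>i\<in>{1..r}. V i), {})"
  proof
    assume "contains_ordered_K r s V ((\<Union>i\<in>{1..r}. V i), {})"
    then obtain S where SV: "(\<forall>i\<in>{1..r}. S i \<subseteq> V i \<and> card (S i) = s i) \<and>
        (\<forall>v. (\<forall>i\<in>{1..r}. v i \<in> S i) \<longrightarrow> v ` {1..r} \<in> {})"
      unfolding contains_ordered_K_def snd_conv by (rule exE)
    then have S: "\<forall>i\<in>{1..r}. card (S i) = s i" and no: "\<not> (\<forall>i\<in>{1..r}. v i \<in> S i)" for v
      by blast+
    have "\<forall>i\<in>{1..r}. S i \<noteq> {}" using S assms by (metis card.empty less_numeral_extra(3))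
    then have "\<forall>i\<in>{1..r}. (SOME x. x \<in> S i) \<in> S i" by (metis some_in_eq)
    then show False using no[of "\<lambda>i. SOME x. x \<in> S i"] by blast
  qed
  ultimately have "zarankiewicz_admissible r m s V ((\<Union>i\<in>{1..r}. V i), {})"
    by (simp add: zarankiewicz_admissible_def rgraph_def rpartite_def)
  then have "{card (edges H) |(V :: nat \<Rightarrow> nat set) H. zarankiewicz_admissible r m s V H} \<noteq> {}"
    by blast
  from Max_in[OF finite_zarankiewicz_set this] show ?thesis
    unfolding zarankiewicz_def[symmetric] mem_Collect_eq using that by metis
qed

lemma card_edges_le_zarankiewicz:
  fixes V :: "nat \<Rightarrow> 'a set"
  assumes A: "zarankiewicz_admissible r m s V H"
  shows "card (edges H) \<le> zarankiewicz r m s"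
proof -
  have fin: "finite (verts H)" and U: "verts H = (\<Union>i\<in>{1..r}. V i)"
    and dis: "disjoint_family_on V {1..r}"
    and E: "\<And>e. e \<in> edges H \<Longrightarrow> e \<subseteq> verts H \<and> card e = r"
    and E1: "\<And>e i. e \<in> edges H \<Longrightarrow> i \<in> {1..r} \<Longrightarrow> card (e \<inter> V i) = 1"
    and c: "\<And>i. i \<in> {1..r} \<Longrightarrow> card (V i) = m i"
    and K: "\<not> contains_ordered_K r s V H"
    using A by (auto simp: zarankiewicz_admissible_def rgraph_def rpartite_def)
  obtain f :: "'a \<Rightarrow> nat" where f: "inj_on f (verts H)"
    using finite_imp_inj_to_nat_seg[OF fin] by blast
  have VU: "V i \<subseteq> verts H" if "i \<in> {1..r}" for i using U that by blast
  define W where "W = (\<lambda>i. f ` V i)"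
  define G where "G = (f ` verts H, (`) f ` edges H)"
  have inj: "inj_on ((`) f) (edges H)"
    using E f by (meson inj_onI inj_on_image_eq_iff)
  have "rgraph r G"
    unfolding rgraph_def G_def using fin E f by (auto simp: card_image inj_on_subset)
  moreover have "rpartite r W G"
  proof -
    have "disjoint_family_on W {1..r}"
      unfolding disjoint_family_on_def W_def
    proof (intro ballI impI)
      fix i j assume ij: "i \<in> {1..r}" "j \<in> {1..r}" "i \<noteq> j"
      then have "V i \<inter> V j = {}" using dis by (auto simp: disjoint_family_on_def)
      then show "f ` V i \<inter> f ` V j = {}"
        using inj_on_image_Int[OF f VU VU, of i j] ij by simp
    qed
    moreover have "card (f ` e \<inter> W i) = 1" if "e \<in> edges H" "i \<in> {1..r}" for e i
    proof -
      have "f ` e \<inter> W i = f ` (e \<inter> V i)"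
        unfolding W_def using inj_on_image_Int[OF f, of e "V i"] E VU that by simp
      moreover have "inj_on f (e \<inter> V i)" using f E that by (meson inf.coboundedI1 inj_on_subset)
      ultimately show ?thesis using E1[OF that] by (simp add: card_image)
    qed
    ultimately show ?thesis by (auto simp: rpartite_def G_def W_def U)
  qed
  moreover have "card (W i) = m i" if "i \<in> {1..r}" for i
    unfolding W_def using c that card_image[OF inj_on_subset[OF f VU]] by simp
  moreover have "\<not> contains_ordered_K r s W G"
  proof
    assume "contains_ordered_K r s W G"
    then obtain S where S: "\<And>i. i \<in> {1..r} \<Longrightarrow> S i \<subseteq> f ` V i \<and> card (S i) = s i"
      and SE: "\<And>v. \<forall>i\<in>{1..r}. v i \<in> S i \<Longrightarrow> v ` {1..r} \<in> (`) f ` edges H"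
      unfolding contains_ordered_K_def W_def G_def snd_conv by blast
    define T where "T = (\<lambda>i. {x \<in> V i. f x \<in> S i})"
    have T: "T i \<subseteq> V i \<and> card (T i) = s i" if i: "i \<in> {1..r}" for i
    proof -
      have "f ` T i = S i" using S[OF i] by (auto simp: T_def)
      moreover have "inj_on f (T i)"
        by (rule inj_on_subset[OF f]) (use VU[OF i] in \<open>auto simp: T_def\<close>)
      ultimately have "card (T i) = card (S i)" using card_image by metis
      then show ?thesis using S[OF i] by (auto simp: T_def)
    qed
    have "v ` {1..r} \<in> edges H" if v: "\<forall>i\<in>{1..r}. v i \<in> T i" for v
    proof -
      have "(f \<circ> v) ` {1..r} \<in> (`) f ` edges H"
        using v by (intro SE) (auto simp: T_def)
      then obtain e where e: "e \<in> edges H" "f ` (v ` {1..r}) = f ` e"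
        by (auto simp: image_comp)
      moreover have "v ` {1..r} \<subseteq> verts H" using v T VU by blast
      ultimately have "v ` {1..r} = e" using E f by (metis inj_on_image_eq_iff)
      then show ?thesis using e by simp
    qed
    then have "contains_ordered_K r s V H"
      using T unfolding contains_ordered_K_def by blast
    then show False using K by simp
  qed
  ultimately have "zarankiewicz_admissible r m s W G"
    by (simp add: zarankiewicz_admissible_def)
  moreover have "card (edges G) = card (edges H)"
    using inj by (simp add: G_def card_image)
  ultimately have "card (edges H) \<in>
      {card (edges H) |(V :: nat \<Rightarrow> nat set) H. zarankiewicz_admissible r m s V H}"
    unfolding mem_Collect_eq by metis
  then show ?thesis
    unfolding zarankiewicz_def using Max_ge[OF finite_zarankiewicz_set] by blast
qed

end

theory Submission
  imports
    Defs
    "HOL-Algebra.Algebraic_Closure_Type"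
    "HOL-Library.Function_Algebras"
    "HOL-Library.Z2"
begin

text \<open>
  Upper bound: for a vertex \<open>v\<close> of the last part, Jensen's inequality bounds from below the number
  of families of \<open>s i\<close> vertices in each part \<open>i < r\<close>, repetitions allowed, that are completely joined
  to \<open>v\<close>. Summed over \<open>v\<close>, a family without repetitions is counted fewer than \<open>t\<close> times, and a family
  with repetitions at most \<open>n\<close> times; since \<open>m i \<ge> n\<close>, the latter contribute no more than the former.

  Lower bound: put \<open>k = p - 1\<close>. It suffices to attach to every tuple in the first \<open>r - 1\<close> parts a
  subset of the last part of size about \<open>n powr (k / p)\<close> such that any \<open>p\<close> of these sets have fewer
  than \<open>t\<close> common elements. For \<open>n\<close> about \<open>q ^ p\<close> the last part is \<open>F\<^bsub>q^k\<^esub> \<times> F\<^bsub>q\<^esub>\<close>, and the sets are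
  \<open>{(x, N (x - \<alpha>))}\<close>, where \<open>N\<close> is the norm from the field with \<open>q ^ (k * D)\<close> elements to \<open>F\<^bsub>q\<^esub>\<close> and
  \<open>\<alpha>\<close> represents an orbit of \<open>x \<mapsto> x ^ q ^ k\<close> on the big field. With \<open>x\<^sub>j = x ^ q ^ j\<close>, the norm
  factors as the product over \<open>j < k\<close> of \<open>f\<^sub>\<alpha>\<^sub>j(x\<^sub>j)\<close>, where for fixed \<open>j\<close> the polynomials \<open>f\<^sub>\<alpha>\<^sub>j\<close> have
  degree \<open>D\<close> and are pairwise coprime. If \<open>k + 1\<close> such products agree with \<open>g\<close> on a set \<open>Z\<close>, expand
  each factor of a monomial of degree at most \<open>(N + 1) * D\<close> in every \<open>x\<^sub>j\<close> into partial fractions: each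
  resulting term selects one of \<open>k + 1\<close> indices for each of the \<open>k\<close> variables, so some index is never
  selected and its product divides the term. Hence on \<open>Z\<close> the monomial is \<open>g\<close> times a polynomial of
  degree at most \<open>N * D\<close> in every \<open>x\<^sub>j\<close>, as long as \<open>N \<ge> k\<close>. Iterating, the functions on \<open>Z\<close> are spanned
  by \<open>(k * D + 1) ^ k\<close> monomials. Taking \<open>D\<close> about \<open>t powr (1 / k) / k\<^sup>2\<close> makes this less than \<open>t\<close>
  while leaving at least \<open>q ^ (k * D) / D\<close> sets.
\<close>

hide_const (open) Divisibility.prime module.smult up_ring.monom up_ring.coeff
  Polynomials.degree Polynomials.lead_coeff

section \<open>The upper bound\<close>

lemma power_mean:
  fixes f :: "'a \<Rightarrow> real"
  assumes "finite A" "\<And>x. x \<in> A \<Longrightarrow> 0 \<le> f x"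
  shows "card A * (sum f A / card A) ^ n \<le> (\<Sum>x\<in>A. f x ^ n)"
proof (cases "A = {}")
  case False
  have conv: "convex_on {0..} (\<lambda>x::real. x ^ n)"
  proof (cases "even n")
    case True
    then show ?thesis using convex_on_subset[OF convex_power_even] by blast
  qed (rule convex_power_odd)
  have "(\<Sum>x\<in>A. (1 / card A) *\<^sub>R f x) ^ n \<le> (\<Sum>x\<in>A. (1 / card A) * f x ^ n)"
    using assms False by (intro convex_on_sum[OF _ _ conv]) auto
  then have "(sum f A / card A) ^ n \<le> (\<Sum>x\<in>A. f x ^ n) / card A"
    by (simp add: sum_divide_distrib)
  then show ?thesis
    using assms(1) False by (simp add: field_simps card_gt_0_iff)
qed simp

lemma sum_PiE_insert:
  fixes g :: "('i \<Rightarrow> 'v) \<Rightarrow> 'c::comm_monoid_add"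
  assumes "j \<notin> I"
  shows "(\<Sum>x\<in>PiE (insert j I) S. g x) = (\<Sum>x\<in>PiE I S. \<Sum>y\<in>S j. g (x(j := y)))"
proof -
  have "(\<Sum>x\<in>PiE (insert j I) S. g x) = (\<Sum>(y, x)\<in>S j \<times> PiE I S. g (x(j := y)))"
    unfolding PiE_insert_eq
    by (subst sum.reindex) (use assms inj_combinator in \<open>auto simp: case_prod_beta\<close>)
  then show ?thesis
    by (simp add: sum.cartesian_product[symmetric] sum.swap[of _ "S j"])
qed

lemma prod_PiE_insert:
  fixes g :: "('i \<Rightarrow> 'v) \<Rightarrow> 'c::comm_monoid_mult"
  assumes "j \<notin> I"
  shows "(\<Prod>x\<in>PiE (insert j I) S. g x) = (\<Prod>y\<in>S j. \<Prod>x\<in>PiE I S. g (x(j := y)))"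
proof -
  have "(\<Prod>x\<in>PiE (insert j I) S. g x) = (\<Prod>(y, x)\<in>S j \<times> PiE I S. g (x(j := y)))"
    unfolding PiE_insert_eq
    by (subst prod.reindex) (use assms inj_combinator in \<open>auto simp: case_prod_beta\<close>)
  then show ?thesis
    by (simp add: prod.cartesian_product[symmetric])
qed

text \<open>A lower bound of Sidorenko type for complete multipartite blow-ups, by induction on the
  parts. For a fixed \<open>\<xi>\<close> on the old parts, the sum over the
  \<open>\<sigma> j\<close> choices in the new part \<open>j\<close> is the
  \<open>\<sigma> j\<close>-th power of one sum over \<open>y\<close>. Jensen is then applied twice:
  over \<open>\<xi>\<close>, and over \<open>y\<close> after the induction hypothesis for
  \<open>f\<close> with coordinate \<open>j\<close> frozen at \<open>y\<close>.\<close>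

lemma blowup_count_ge:
  fixes f :: "('i \<Rightarrow> 'v) \<Rightarrow> real"
  assumes "finite I" "\<And>i. i \<in> I \<Longrightarrow> finite (V i)" "\<And>i. i \<in> I \<Longrightarrow> V i \<noteq> {}" "\<And>x. 0 \<le> f x"
  shows "(\<Prod>i\<in>I. real (card (V i)) ^ \<sigma> i) *
           ((\<Sum>x\<in>PiE I V. f x) / (\<Prod>i\<in>I. real (card (V i)))) ^ (\<Prod>i\<in>I. \<sigma> i)
         \<le> (\<Sum>\<xi>\<in>PiE I (\<lambda>i. {..<\<sigma> i} \<rightarrow>\<^sub>E V i). \<Prod>a\<in>PiE I (\<lambda>i. {..<\<sigma> i}). f (\<lambda>i\<in>I. \<xi> i (a i)))"
  using assms
proof (induction I arbitrary: f rule: finite_induct)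
  case empty
  then show ?case by simp
next
  case (insert j I)
  define \<Xi> where "\<Xi> = PiE I (\<lambda>i. {..<\<sigma> i} \<rightarrow>\<^sub>E V i)"
  \<comment> \<open>\<open>F \<xi> y\<close> is the weight of the blow-up \<open>\<xi>\<close> with
    \<open>y\<close> in part \<open>j\<close>; \<open>D y\<close> is the density of the slice at
    \<open>y\<close>.\<close>
  define F where "F \<xi> y = (\<Prod>a\<in>PiE I (\<lambda>i. {..<\<sigma> i}). f ((\<lambda>i\<in>I. \<xi> i (a i))(j := y)))" for \<xi> y
  define P where "P = (\<Prod>i\<in>I. real (card (V i)))"
  define Q where "Q = (\<Prod>i\<in>I. real (card (V i)) ^ \<sigma> i)"
  define \<pi> where "\<pi> = (\<Prod>i\<in>I. \<sigma> i)"
  define v where "v = real (card (V j))"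
  define D where "D y = (\<Sum>x\<in>PiE I V. f (x(j := y))) / P" for y
  have v: "v > 0" unfolding v_def using insert.prems by (simp add: card_gt_0_iff)
  have P: "P > 0" unfolding P_def using insert.prems by (intro prod_pos) (simp add: card_gt_0_iff)
  have Q: "Q > 0" unfolding Q_def using insert.prems by (intro prod_pos) (simp add: card_gt_0_iff)
  have finX: "finite \<Xi>"
    unfolding \<Xi>_def using insert by (intro finite_PiE) auto
  have cX: "real (card \<Xi>) = Q"
    unfolding \<Xi>_def Q_def using insert.hyps by (simp add: card_PiE)
  have F0: "F \<xi> y \<ge> 0" for \<xi> y
    unfolding F_def using insert.prems by (intro prod_nonneg) auto
  have D0: "D y \<ge> 0" for y
    unfolding D_def using insert.prems P by (intro divide_nonneg_pos sum_nonneg) auto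
  have IH: "Q * D y ^ \<pi> \<le> (\<Sum>\<xi>\<in>\<Xi>. F \<xi> y)" for y
    unfolding Q_def D_def \<pi>_def \<Xi>_def F_def P_def
    by (rule insert.IH) (use insert.prems in auto)
  have "(\<Sum>\<xi>\<in>PiE (insert j I) (\<lambda>i. {..<\<sigma> i} \<rightarrow>\<^sub>E V i).
          \<Prod>a\<in>PiE (insert j I) (\<lambda>i. {..<\<sigma> i}). f (\<lambda>i\<in>insert j I. \<xi> i (a i)))
      = (\<Sum>\<xi>\<in>\<Xi>. \<Sum>\<eta>\<in>{..<\<sigma> j} \<rightarrow>\<^sub>E V j. \<Prod>b<\<sigma> j. F \<xi> (\<eta> b))"
    unfolding sum_PiE_insert[OF insert.hyps(2)] prod_PiE_insert[OF insert.hyps(2)] \<Xi>_def F_def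
    using insert.hyps
    by (intro sum.cong prod.cong refl arg_cong[of _ _ f]) (auto simp: fun_eq_iff)
  also have "\<dots> = (\<Sum>\<xi>\<in>\<Xi>. (\<Sum>y\<in>V j. F \<xi> y) ^ \<sigma> j)"
    using insert.prems by (subst prod_sum_PiE[symmetric]) auto
  also have "\<dots> \<ge> Q * ((\<Sum>\<xi>\<in>\<Xi>. \<Sum>y\<in>V j. F \<xi> y) / Q) ^ \<sigma> j"
    using power_mean[OF finX, of "\<lambda>\<xi>. \<Sum>y\<in>V j. F \<xi> y" "\<sigma> j"] F0
    by (simp add: cX sum_nonneg)
  moreover have "Q * ((\<Sum>\<xi>\<in>\<Xi>. \<Sum>y\<in>V j. F \<xi> y) / Q) ^ \<sigma> j
      \<ge> Q * (v * ((\<Sum>y\<in>V j. D y) / v) ^ \<pi>) ^ \<sigma> j"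
  proof -
    have "v * ((\<Sum>y\<in>V j. D y) / v) ^ \<pi> \<le> (\<Sum>y\<in>V j. D y ^ \<pi>)"
      unfolding v_def using insert.prems D0 by (intro power_mean) auto
    also have "\<dots> \<le> (\<Sum>y\<in>V j. (\<Sum>\<xi>\<in>\<Xi>. F \<xi> y) / Q)"
      using IH Q by (intro sum_mono) (simp add: field_simps)
    also have "\<dots> = (\<Sum>\<xi>\<in>\<Xi>. \<Sum>y\<in>V j. F \<xi> y) / Q"
      by (subst sum.swap) (simp add: sum_divide_distrib)
    finally show ?thesis
      using Q v D0 by (intro mult_left_mono power_mono)
        (auto intro!: mult_nonneg_nonneg zero_le_power divide_nonneg_pos sum_nonneg)
  qed
  moreover have "Q * (v * ((\<Sum>y\<in>V j. D y) / v) ^ \<pi>) ^ \<sigma> j =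
      (\<Prod>i\<in>insert j I. real (card (V i)) ^ \<sigma> i) *
        ((\<Sum>x\<in>PiE (insert j I) V. f x) / (\<Prod>i\<in>insert j I. real (card (V i)))) ^ (\<Prod>i\<in>insert j I. \<sigma> i)"
  proof -
    have "(\<Sum>x\<in>PiE (insert j I) V. f x) = P * (\<Sum>y\<in>V j. D y)"
      unfolding sum_PiE_insert[OF insert.hyps(2)] D_def using P
      by (subst sum.swap) (simp add: sum_divide_distrib[symmetric])
    then show ?thesis
      using insert.hyps P
      by (simp add: Q_def[symmetric] P_def[symmetric] \<pi>_def[symmetric] v_def[symmetric]
          power_mult_distrib power_mult[symmetric] mult.commute)
  qed
  ultimately show ?case by linarith
qed

text \<open>Overwriting \<open>\<xi> i a\<close> by an arbitrary element of \<open>V i\<close> loses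
  nothing, since the old value is still stored at \<open>\<xi> i b\<close>; this embeds the
  collisions times \<open>V i\<close> into all families.\<close>

lemma card_collision_le:
  fixes V :: "'i \<Rightarrow> 'v set" and a b :: nat
  assumes "finite I" "\<And>i. i \<in> I \<Longrightarrow> finite (V i)" "i \<in> I" "a < \<sigma> i" "b < \<sigma> i" "a \<noteq> b"
  shows "card {\<xi> \<in> PiE I (\<lambda>i. {..<\<sigma> i} \<rightarrow>\<^sub>E V i). \<xi> i a = \<xi> i b} * card (V i)
         \<le> card (PiE I (\<lambda>i. {..<\<sigma> i} \<rightarrow>\<^sub>E V i))"
proof -
  let ?X = "PiE I (\<lambda>i. {..<\<sigma> i} \<rightarrow>\<^sub>E V i)"
  let ?B = "{\<xi> \<in> ?X. \<xi> i a = \<xi> i b}"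
  define \<Phi> where "\<Phi> = (\<lambda>(\<xi> :: 'i \<Rightarrow> nat \<Rightarrow> 'v, y). \<xi>(i := (\<xi> i)(a := y)))"
  have "inj_on \<Phi> (?B \<times> V i)"
  proof (rule inj_on_inverseI[where g = "\<lambda>\<zeta>. (\<zeta>(i := (\<zeta> i)(a := \<zeta> i b)), \<zeta> i a)"])
    fix z assume "z \<in> ?B \<times> V i"
    then show "((\<Phi> z)(i := (\<Phi> z i)(a := \<Phi> z i b)), \<Phi> z i a) = z"
      using assms by (cases z) (auto simp: \<Phi>_def fun_eq_iff)
  qed
  moreover have "\<Phi> ` (?B \<times> V i) \<subseteq> ?X"
  proof
    fix \<zeta> assume "\<zeta> \<in> \<Phi> ` (?B \<times> V i)"
    then obtain \<xi> y where \<xi>: "\<xi> \<in> ?X" "y \<in> V i" "\<zeta> = \<xi>(i := (\<xi> i)(a := y))"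
      by (auto simp: \<Phi>_def)
    have "\<xi> i \<in> {..<\<sigma> i} \<rightarrow>\<^sub>E V i" using PiE_mem[OF \<xi>(1) assms(3)] .
    then have "(\<xi> i)(a := y) \<in> {..<\<sigma> i} \<rightarrow>\<^sub>E V i"
      using assms(4) \<xi>(2) by (auto simp: PiE_iff extensional_def)
    then show "\<zeta> \<in> ?X"
      using \<xi>(1,3) assms(3) by (auto simp: PiE_iff extensional_def)
  qed
  moreover have "finite ?X" using assms by (intro finite_PiE) auto
  ultimately have "card (?B \<times> V i) \<le> card ?X" by (rule card_inj_on_le)
  then show ?thesis by (simp add: card_cartesian_product)
qed

text \<open>The pairs of a vertex \<open>v\<close> and a family \<open>\<xi>\<close> completely
  joined to \<open>v\<close> are counted twice. In the constant, \<open>t\<close> pays for the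
  families without repetition, and \<open>s i ^ 2\<close> bounds the number of index pairs that can
  collide in part \<open>i\<close>.\<close>

lemma zarankiewicz_upper:
  fixes r t p n :: nat and s m :: "nat \<Rightarrow> nat"
  assumes r: "r \<ge> 2"
    and s: "\<And>i. i \<in> {1..r - 1} \<Longrightarrow> s i > 0"
    and t: "t > 0"
    and p: "p = (\<Prod>i = 1..r - 1. s i)"
    and n: "n > 0"
    and m: "\<And>i. i \<in> {1..r - 1} \<Longrightarrow> m i \<ge> n"
  shows "real (zarankiewicz r (m(r := n)) (s(r := t)))
    \<le> (real t + (\<Sum>i = 1..r - 1. real (s i) ^ 2)) * real (\<Prod>i = 1..r - 1. m i)
       * real n powr (1 - 1 / real p)"
proof -
  define I where "I = {1..r - 1}"
  have Ir: "{1..r} = insert r I" "r \<notin> I" "finite I" using r by (auto simp: I_def)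
  have m0: "m i > 0" if "i \<in> I" for i using m[of i] n that by (auto simp: I_def)
  obtain V :: "nat \<Rightarrow> nat set" and H
    where A: "zarankiewicz_admissible r (m(r := n)) (s(r := t)) V H"
      and E: "card (edges H) = zarankiewicz r (m(r := n)) (s(r := t))"
    by (rule zarankiewicz_attained[of r "s(r := t)" "m(r := n)"]) (use s t r in auto)
  have U: "verts H = (\<Union>i\<in>{1..r}. V i)"
    and Esub: "\<And>e. e \<in> edges H \<Longrightarrow> e \<subseteq> verts H"
    and E1: "\<And>e i. e \<in> edges H \<Longrightarrow> i \<in> {1..r} \<Longrightarrow> card (e \<inter> V i) = 1"
    and c: "\<And>i. i \<in> {1..r} \<Longrightarrow> card (V i) = (m(r := n)) i"
    and K: "\<not> contains_ordered_K r (s(r := t)) V H"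
    using A by (auto simp: zarankiewicz_admissible_def rgraph_def rpartite_def)
  have cI: "card (V i) = m i" if "i \<in> I" for i
    using that r by (subst c) (auto simp: I_def)
  have cr: "card (V r) = n" using c[of r] r by simp
  have finI: "finite (V i)" if "i \<in> I" for i
    using cI[OF that] m0[OF that] by (intro card_ge_0_finite) simp
  have finr: "finite (V r)" using cr n by (intro card_ge_0_finite) simp
  have neI: "V i \<noteq> {}" if "i \<in> I" for i using cI[OF that] m0[OF that] by auto
  define P where "P = (\<Prod>i\<in>I. real (m i))"
  define \<Xi> where "\<Xi> = PiE I (\<lambda>i. {..<s i} \<rightarrow>\<^sub>E V i)"
  define Q where "Q = (\<Prod>i\<in>I. real (m i) ^ s i)"
  define f :: "nat \<Rightarrow> (nat \<Rightarrow> nat) \<Rightarrow> real" where "f v x = of_bool (insert v (x ` I) \<in> edges H)" for v x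
  define S where "S v = (\<Sum>x\<in>PiE I V. f v x)" for v
  define N where "N \<xi> = {v \<in> V r. \<forall>a\<in>PiE I (\<lambda>i. {..<s i}). insert v ((\<lambda>i. \<xi> i (a i)) ` I) \<in> edges H}" for \<xi>
  define L where "L = real t + (\<Sum>i\<in>I. real (s i) ^ 2)"
  have P0: "P > 0" unfolding P_def using m0 by (intro prod_pos) auto
  have Q0: "Q > 0" unfolding Q_def using m0 by (intro prod_pos) auto
  have fin\<Xi>: "finite \<Xi>" unfolding \<Xi>_def using Ir finI by (intro finite_PiE) auto
  have c\<Xi>: "real (card \<Xi>) = Q"
    unfolding \<Xi>_def Q_def using Ir cI by (simp add: card_PiE)
  have finX: "finite (PiE I V)" using Ir finI by (intro finite_PiE) auto

  \<comment> \<open>An edge meets every part in exactly one vertex, so it is recovered from its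
    vertex in \<open>V r\<close> and a tuple in the other parts.\<close>
  have edges_le: "real (card (edges H)) \<le> (\<Sum>v\<in>V r. S v)"
  proof -
    let ?T = "{(v, x) \<in> V r \<times> PiE I V. insert v (x ` I) \<in> edges H}"
    have finT: "finite ?T" by (rule finite_subset[of _ "V r \<times> PiE I V"]) (use finX finr in auto)
    have "edges H \<subseteq> (\<lambda>(v, x). insert v (x ` I)) ` ?T"
    proof
      fix e assume e: "e \<in> edges H"
      then have "\<forall>i\<in>{1..r}. \<exists>w. e \<inter> V i = {w}" using E1 by (metis card_1_singletonE)
      then obtain w where w: "\<And>i. i \<in> {1..r} \<Longrightarrow> e \<inter> V i = {w i}" by metis
      have "e = (\<Union>i\<in>{1..r}. e \<inter> V i)" using Esub[OF e] unfolding U by blast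
      also have "\<dots> = (\<Union>i\<in>{1..r}. {w i})" using w by (intro SUP_cong refl)
      also have "\<dots> = insert (w r) (restrict w I ` I)" unfolding Ir(1) by auto
      finally have ee: "e = insert (w r) (restrict w I ` I)" .
      moreover have "restrict w I \<in> PiE I V" "w r \<in> V r" using w unfolding Ir(1) by auto
      ultimately show "e \<in> (\<lambda>(v, x). insert v (x ` I)) ` ?T"
        using e by (intro image_eqI[of _ _ "(w r, restrict w I)"]) auto
    qed
    then have "card (edges H) \<le> card ?T"
      by (rule surj_card_le[OF finT])
    also have "real (card ?T) = (\<Sum>(v, x)\<in>V r \<times> PiE I V. f v x)"
    proof -
      have "(\<Sum>(v, x)\<in>V r \<times> PiE I V. f v x) = (\<Sum>z\<in>V r \<times> PiE I V. of_bool (z \<in> ?T))"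
        by (rule sum.cong) (auto simp: f_def)
      also have "\<dots> = real (card (V r \<times> PiE I V \<inter> ?T))"
        using finX finr by (subst sum_of_bool_eq) (auto simp: Collect_mem_eq)
      also have "V r \<times> PiE I V \<inter> ?T = ?T" by auto
      finally show ?thesis by simp
    qed
    finally show ?thesis by (simp add: S_def sum.cartesian_product)
  qed

  have "real n * ((\<Sum>v\<in>V r. S v / P) / n) ^ p \<le> (\<Sum>v\<in>V r. (S v / P) ^ p)"
    unfolding cr[symmetric] using finr P0
    by (intro power_mean) (auto simp: S_def f_def intro!: divide_nonneg_pos sum_nonneg)
  then have "Q * (real n * ((\<Sum>v\<in>V r. S v / P) / n) ^ p) \<le> (\<Sum>v\<in>V r. Q * (S v / P) ^ p)"
    using Q0 by (simp add: sum_distrib_left[symmetric])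
  also have "\<dots> \<le> (\<Sum>v\<in>V r. \<Sum>\<xi>\<in>\<Xi>. \<Prod>a\<in>PiE I (\<lambda>i. {..<s i}). f v (\<lambda>i\<in>I. \<xi> i (a i)))"
  proof (rule sum_mono)
    fix v assume "v \<in> V r"
    have "(\<Prod>i\<in>I. real (card (V i)) ^ s i) *
           ((\<Sum>x\<in>PiE I V. f v x) / (\<Prod>i\<in>I. real (card (V i)))) ^ (\<Prod>i\<in>I. s i)
         \<le> (\<Sum>\<xi>\<in>PiE I (\<lambda>i. {..<s i} \<rightarrow>\<^sub>E V i). \<Prod>a\<in>PiE I (\<lambda>i. {..<s i}). f v (\<lambda>i\<in>I. \<xi> i (a i)))"
      using Ir finI neI by (intro blowup_count_ge) (auto simp: f_def)
    then show "Q * (S v / P) ^ p \<le> (\<Sum>\<xi>\<in>\<Xi>. \<Prod>a\<in>PiE I (\<lambda>i. {..<s i}). f v (\<lambda>i\<in>I. \<xi> i (a i)))"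
      using p cI by (simp add: Q_def S_def P_def \<Xi>_def I_def)
  qed
  also have "\<dots> = (\<Sum>\<xi>\<in>\<Xi>. real (card (N \<xi>)))"
  proof -
    have "(\<Sum>v\<in>V r. \<Prod>a\<in>PiE I (\<lambda>i. {..<s i}). f v (\<lambda>i\<in>I. \<xi> i (a i))) = real (card (N \<xi>))" for \<xi>
    proof -
      have fa: "finite (PiE I (\<lambda>i. {..<s i}))" using Ir by (intro finite_PiE) auto
      have "(\<Prod>a\<in>PiE I (\<lambda>i. {..<s i}). f v (\<lambda>i\<in>I. \<xi> i (a i))) = of_bool (v \<in> N \<xi>)"
        if "v \<in> V r" for v
      proof (cases "v \<in> N \<xi>")
        case True
        then show ?thesis by (auto simp: N_def f_def intro!: prod.neutral)
      next
        case False
        then show ?thesis using fa that by (auto simp: N_def f_def)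
      qed
      then have "(\<Sum>v\<in>V r. \<Prod>a\<in>PiE I (\<lambda>i. {..<s i}). f v (\<lambda>i\<in>I. \<xi> i (a i)))
          = (\<Sum>v\<in>V r. of_bool (v \<in> N \<xi>))" by simp
      also have "\<dots> = real (card (V r \<inter> N \<xi>))"
        using finr by (subst sum_of_bool_eq) (auto simp: Collect_mem_eq)
      also have "V r \<inter> N \<xi> = N \<xi>" by (auto simp: N_def)
      finally show ?thesis .
    qed
    then show ?thesis by (subst sum.swap) simp
  qed
  also have "\<dots> \<le> L * Q"
  proof -
    \<comment> \<open>For each pair of indices the colliding families form a fraction at most
      \<open>1 / m i\<close>, hence at most \<open>1 / n\<close>; this cancels the trivial bound
      \<open>n\<close> on \<open>card (N \<xi>)\<close>.\<close>
    define B where "B i = {\<xi> \<in> \<Xi>. \<not> inj_on (\<xi> i) {..<s i}}" for i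
    have finB: "finite (B i)" for i unfolding B_def using fin\<Xi> by auto
    have cB: "real n * real (card (B i)) \<le> real (s i) ^ 2 * Q" if i: "i \<in> I" for i
    proof -
      let ?C = "\<lambda>(a, b). {\<xi> \<in> \<Xi>. \<xi> i a = \<xi> i b}"
      let ?J = "{(a, b) \<in> {..<s i} \<times> {..<s i}. a \<noteq> b}"
      have finJ: "finite ?J" by (rule finite_subset[of _ "{..<s i} \<times> {..<s i}"]) auto
      have cJ: "card ?J \<le> s i * s i"
        using card_mono[of "{..<s i} \<times> {..<s i}" ?J] by auto
      have "B i \<subseteq> (\<Union>z\<in>?J. ?C z)" by (auto simp: B_def inj_on_def)
      then have "card (B i) \<le> card (\<Union>z\<in>?J. ?C z)"
        by (rule card_mono[rotated]) (use finJ fin\<Xi> in auto)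
      also have "\<dots> \<le> (\<Sum>z\<in>?J. card (?C z))" using finJ by (rule card_UN_le)
      finally have "real n * real (card (B i)) \<le> (\<Sum>z\<in>?J. real n * real (card (?C z)))"
        unfolding sum_distrib_left[symmetric] of_nat_sum[symmetric]
        by (intro mult_left_mono of_nat_mono) auto
      also have "\<dots> \<le> (\<Sum>z\<in>?J. Q)"
      proof (rule sum_mono)
        fix z assume "z \<in> ?J"
        then obtain a b where z: "z = (a, b)" "a < s i" "b < s i" "a \<noteq> b" by auto
        have "card (?C z) * m i \<le> card \<Xi>"
          using card_collision_le[of I V i a s b] Ir finI i z cI[OF i] by (simp add: \<Xi>_def)
        moreover have "n * card (?C z) \<le> card (?C z) * m i"
          using m[of i] i by (simp add: I_def)
        ultimately have "n * card (?C z) \<le> card \<Xi>" by linarith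
        then show "real n * real (card (?C z)) \<le> Q"
          unfolding c\<Xi>[symmetric] of_nat_mult[symmetric] by (rule of_nat_mono)
      qed
      also have "\<dots> \<le> real (s i) ^ 2 * Q"
        using cJ Q0 by (simp add: power2_eq_square flip: of_nat_mult)
      finally show ?thesis .
    qed
    have "real (card (N \<xi>)) \<le> real t + (\<Sum>i\<in>I. real n * of_bool (\<xi> \<in> B i))" if \<xi>: "\<xi> \<in> \<Xi>" for \<xi>
    proof (cases "\<forall>i\<in>I. inj_on (\<xi> i) {..<s i}")
      case True
      have "card (N \<xi>) < t"
      proof (rule ccontr)
        assume "\<not> card (N \<xi>) < t"
        then obtain T where T: "T \<subseteq> N \<xi>" "card T = t"
          using obtain_subset_with_card_n[of t "N \<xi>"] by auto
        \<comment> \<open>\<open>t\<close> common neighbours of a repetition-free family would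
          complete an ordered copy of the forbidden hypergraph.\<close>
        define W where "W = (\<lambda>i. \<xi> i ` {..<s i})(r := T)"
        have "W i \<subseteq> V i \<and> card (W i) = (s(r := t)) i" if ir: "i \<in> {1..r}" for i
        proof (cases "i = r")
          case True
          then show ?thesis using T by (auto simp: W_def N_def)
        next
          case False
          then have i: "i \<in> I" using ir Ir(1) by blast
          then have "\<xi> i \<in> {..<s i} \<rightarrow>\<^sub>E V i" using \<xi> by (auto simp: \<Xi>_def)
          then show ?thesis using False i True by (auto simp: W_def card_image)
        qed
        moreover have "w ` {1..r} \<in> edges H" if w: "\<forall>i\<in>{1..r}. w i \<in> W i" for w
        proof -
          have "\<exists>a<s i. w i = \<xi> i a" if "i \<in> I" for i
          proof -
            have "w i \<in> W i" using w that Ir(1) by blast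
            moreover have "i \<noteq> r" using that Ir(2) by blast
            ultimately show ?thesis by (auto simp: W_def)
          qed
          then obtain a where a: "\<And>i. i \<in> I \<Longrightarrow> a i < s i \<and> w i = \<xi> i (a i)" by metis
          have "w r \<in> W r" using w Ir(1) by blast
          then have "w r \<in> N \<xi>" using T by (auto simp: W_def)
          moreover have "restrict a I \<in> PiE I (\<lambda>i. {..<s i})" using a by auto
          ultimately have "insert (w r) ((\<lambda>i. \<xi> i (restrict a I i)) ` I) \<in> edges H"
            unfolding N_def by blast
          moreover have "(\<lambda>i. \<xi> i (restrict a I i)) ` I = w ` I"
            using a by (intro image_cong) auto
          ultimately show ?thesis unfolding Ir(1) by simp
        qed
        ultimately have "contains_ordered_K r (s(r := t)) V H"
          unfolding contains_ordered_K_def by blast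
        then show False using K by simp
      qed
      then show ?thesis
        by (simp add: add_increasing2 sum_nonneg)
    next
      case False
      then obtain i where i: "i \<in> I" "\<xi> \<in> B i" using \<xi> by (auto simp: B_def)
      have "card (N \<xi>) \<le> card (V r)" unfolding N_def using finr by (intro card_mono) auto
      then have "real (card (N \<xi>)) \<le> real n * of_bool (\<xi> \<in> B i)" using i cr by simp
      also have "\<dots> \<le> (\<Sum>i\<in>I. real n * of_bool (\<xi> \<in> B i))"
        using i Ir by (intro member_le_sum) auto
      finally show ?thesis by simp
    qed
    then have "(\<Sum>\<xi>\<in>\<Xi>. real (card (N \<xi>))) \<le> (\<Sum>\<xi>\<in>\<Xi>. real t + (\<Sum>i\<in>I. real n * of_bool (\<xi> \<in> B i)))"
      by (rule sum_mono)
    also have "\<dots> = real t * Q + (\<Sum>i\<in>I. real n * (\<Sum>\<xi>\<in>\<Xi>. of_bool (\<xi> \<in> B i)))"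
      using c\<Xi> by (simp add: sum.distrib sum.swap[of _ I] sum_distrib_left)
    also have "\<dots> = real t * Q + (\<Sum>i\<in>I. real n * real (card (B i)))"
    proof -
      have "(\<Sum>\<xi>\<in>\<Xi>. of_bool (\<xi> \<in> B i)) = real (card (\<Xi> \<inter> B i))" for i
        using fin\<Xi> by (subst sum_of_bool_eq) (auto simp: Collect_mem_eq)
      moreover have "\<Xi> \<inter> B i = B i" for i by (auto simp: B_def)
      ultimately show ?thesis by simp
    qed
    also have "\<dots> \<le> real t * Q + (\<Sum>i\<in>I. real (s i) ^ 2 * Q)"
      using cB by (intro add_left_mono sum_mono) auto
    also have "\<dots> = L * Q" by (simp add: L_def sum_distrib_right distrib_right)
    finally show ?thesis .
  qed
  finally have main: "real n * ((\<Sum>v\<in>V r. S v / P) / n) ^ p \<le> L"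
    using Q0 by (simp add: mult.commute)
  define d where "d = (\<Sum>v\<in>V r. S v / P) / n"
  have p0: "p > 0" unfolding p using s by (intro prod_pos) auto
  have d0: "d \<ge> 0" unfolding d_def using P0
    by (auto simp: S_def f_def intro!: divide_nonneg_nonneg sum_nonneg)
  have L1: "L \<ge> 1" unfolding L_def using t by (simp add: add_increasing2 sum_nonneg)
  have "d \<le> L * n powr (- 1 / p)"
  proof -
    have "d ^ p \<le> L / n" using main n by (simp add: d_def field_simps)
    \<comment> \<open>Weakening \<open>L\<close> to \<open>L ^ p\<close>, possible as
      \<open>L \<ge> 1\<close>, keeps the constant equal to \<open>L\<close> after the
      \<open>p\<close>-th root.\<close>
    also have "\<dots> \<le> L ^ p / n"
      using L1 p0 by (intro divide_right_mono self_le_power) auto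
    also have "\<dots> = (L * n powr (- 1 / p)) ^ p"
      using n p0 by (simp add: power_mult_distrib powr_power powr_minus_divide power_divide)
    finally show ?thesis
      by (rule power_le_imp_le_base[where n = "p - 1", unfolded Suc_diff_1[OF p0]])
         (use L1 in auto)
  qed
  have "real (card (edges H)) \<le> d * P * n"
    using edges_le P0 n by (simp add: d_def sum_divide_distrib[symmetric])
  also have "\<dots> \<le> (L * n powr (- 1 / p)) * P * n"
    using \<open>d \<le> L * n powr (- 1 / p)\<close> P0 by (intro mult_right_mono) auto
  also have "\<dots> = L * P * (n powr (- 1 / p) * n powr 1)" using n by simp
  also have "n powr (- 1 / p) * n powr 1 = real n powr (1 - 1 / real p)"
    by (subst powr_add[symmetric]) simp
  finally show ?thesis
    unfolding E by (simp add: L_def P_def I_def)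
qed

section \<open>Common values of products of polynomials\<close>

lemma comaximal_prod:
  fixes f :: "'i \<Rightarrow> 'a::comm_ring_1"
  assumes "finite I" "\<And>i. i \<in> I \<Longrightarrow> \<exists>u v. u * a + v * f i = 1"
  shows "\<exists>u v. u * a + v * (\<Prod>i\<in>I. f i) = 1"
  using assms
proof (induction I rule: finite_induct)
  case empty
  then show ?case by (intro exI[of _ 0] exI[of _ 1]) simp
next
  case (insert j I)
  then obtain u v where 1: "u * a + v * (\<Prod>i\<in>I. f i) = 1" by auto
  obtain u' v' where 2: "u' * a + v' * f j = 1" using insert.prems by blast
  have "(u * a + v * (\<Prod>i\<in>I. f i)) * (u' * a + v' * f j)
      = (u * u' * a + u * v' * f j + v * (\<Prod>i\<in>I. f i) * u') * a + v * v' * (f j * (\<Prod>i\<in>I. f i))"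
    by (simp add: algebra_simps)
  then show ?case using insert.hyps by (auto simp: 1 2)
qed

text \<open>Induction on \<open>I\<close>: the identity for \<open>I\<close> is multiplied by
  \<open>a * f j\<close>, where \<open>a * f j + b * (\<Prod>i\<in>I. f i) = 1\<close>, and
  \<open>b\<close> becomes the coefficient at the new index \<open>j\<close>.\<close>

lemma partial_fraction_unit:
  fixes f :: "'i \<Rightarrow> 'a::comm_ring_1"
  assumes "finite I" "I \<noteq> {}"
    and "\<And>i j. i \<in> I \<Longrightarrow> j \<in> I \<Longrightarrow> i \<noteq> j \<Longrightarrow> \<exists>u v. u * f i + v * f j = 1"
  shows "\<exists>u. (\<Sum>i\<in>I. u i * (\<Prod>l\<in>I - {i}. f l)) = 1"
  using assms
proof (induction I rule: finite_ne_induct)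
  case (singleton i)
  then show ?case by (intro exI[of _ "\<lambda>_. 1"]) simp
next
  case (insert j I)
  then obtain u where u: "(\<Sum>i\<in>I. u i * (\<Prod>l\<in>I - {i}. f l)) = 1" by auto
  have "\<exists>a b. a * f j + b * (\<Prod>i\<in>I. f i) = 1"
    using insert by (intro comaximal_prod) auto
  then obtain a b where ab: "a * f j + b * (\<Prod>i\<in>I. f i) = 1" by blast
  define w where "w = (\<lambda>i. a * u i)(j := b)"
  have "w i * (\<Prod>l\<in>insert j I - {i}. f l) = a * f j * (u i * (\<Prod>l\<in>I - {i}. f l))"
    if "i \<in> I" for i
  proof -
    have "insert j I - {i} = insert j (I - {i})" using that insert.hyps by auto
    then show ?thesis using that insert.hyps by (auto simp: w_def algebra_simps)
  qed
  then have "(\<Sum>i\<in>I. w i * (\<Prod>l\<in>insert j I - {i}. f l)) = a * f j"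
    by (simp add: sum_distrib_left[symmetric] u)
  moreover have "insert j I - {j} = I" using insert.hyps by auto
  ultimately have "(\<Sum>i\<in>insert j I. w i * (\<Prod>l\<in>insert j I - {i}. f l)) = 1"
    using insert.hyps ab by (simp add: w_def add.commute)
  then show ?case by blast
qed

text \<open>Multiply the unit decomposition by \<open>h\<close> and reduce each numerator modulo
  \<open>f i\<close>, except at one index \<open>i0\<close> that absorbs all quotients. The
  numerator at \<open>i0\<close> has no degree bound by construction; it inherits one from
  \<open>h\<close> and the other terms.\<close>

lemma partial_fractions_degree:
  fixes f :: "'i \<Rightarrow> 'a::field poly"
  assumes I: "finite I" "card I = Suc k"
    and deg: "\<And>i. i \<in> I \<Longrightarrow> degree (f i) = D" "\<And>i. i \<in> I \<Longrightarrow> f i \<noteq> 0"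
    and com: "\<And>i j. i \<in> I \<Longrightarrow> j \<in> I \<Longrightarrow> i \<noteq> j \<Longrightarrow> \<exists>u v. u * f i + v * f j = 1"
    and h: "degree h \<le> M" "Suc k * D \<le> M"
  shows "\<exists>c. h = (\<Sum>i\<in>I. c i * (\<Prod>l\<in>I - {i}. f l)) \<and> (\<forall>i\<in>I. degree (c i) \<le> M - k * D)"
proof -
  obtain i0 where i0: "i0 \<in> I" using I by fastforce
  define F where "F i = (\<Prod>l\<in>I - {i}. f l)" for i
  obtain u where u: "(\<Sum>i\<in>I. u i * F i) = 1"
    using partial_fraction_unit[of I f] I i0 com unfolding F_def by blast
  have F: "f i * F i = (\<Prod>l\<in>I. f l)" if "i \<in> I" for i
    unfolding F_def by (rule prod.remove[OF I(1) that, symmetric])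
  have degF: "degree (F i) = k * D" if "i \<in> I" for i
  proof -
    have "degree (F i) = (\<Sum>l\<in>I - {i}. degree (f l))"
      unfolding F_def using deg by (intro degree_prod_eq_sum_degree) auto
    also have "\<dots> = k * D" using deg I that by simp
    finally show ?thesis .
  qed
  have F0: "F i \<noteq> 0" for i unfolding F_def using I deg by auto
  define J where "J = I - {i0}"
  have IJ: "I = insert i0 J" "i0 \<notin> J" "finite J" using i0 I by (auto simp: J_def)
  \<comment> \<open>A quotient can be moved from \<open>i\<close> to \<open>i0\<close> because
    \<open>f i * F i\<close> is the full product for every \<open>i\<close>.\<close>
  define c0 where "c0 = h * u i0 + (\<Sum>i\<in>J. (h * u i div f i) * f i0)"
  define c where "c = (\<lambda>i. (h * u i) mod f i)(i0 := c0)"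
  have sumJ: "h = c0 * F i0 + (\<Sum>i\<in>J. ((h * u i) mod f i) * F i)"
  proof -
    have eq: "(h * u i) * F i = (h * u i div f i) * f i0 * F i0 + ((h * u i) mod f i) * F i"
      if "i \<in> J" for i
    proof -
      have "(h * u i) * F i = ((h * u i div f i) * f i + (h * u i) mod f i) * F i" by simp
      also have "\<dots> = (h * u i div f i) * (f i * F i) + ((h * u i) mod f i) * F i"
        by (simp only: algebra_simps)
      also have "f i * F i = f i0 * F i0" using F that i0 by (simp add: J_def)
      finally show ?thesis by (simp add: mult.assoc)
    qed
    have "h = h * (\<Sum>i\<in>I. u i * F i)" using u by simp
    also have "\<dots> = h * u i0 * F i0 + (\<Sum>i\<in>J. (h * u i) * F i)"
      using IJ by (simp add: distrib_left sum_distrib_left mult.assoc)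
    also have "(\<Sum>i\<in>J. (h * u i) * F i)
        = (\<Sum>i\<in>J. (h * u i div f i) * f i0 * F i0 + ((h * u i) mod f i) * F i)"
      using eq by (rule sum.cong[OF refl])
    finally show ?thesis
      by (simp add: c0_def sum.distrib distrib_right sum_distrib_right add.assoc)
  qed
  have degmod: "degree ((h * u i) mod f i) \<le> D" if "i \<in> I" for i
    using degree_mod_less[of "f i" "h * u i"] deg that by fastforce
  have degc: "degree (c i) \<le> M - k * D" if "i \<in> I" for i
  proof (cases "i = i0")
    case True
    have "degree (c0 * F i0) \<le> M"
    proof -
      have "c0 * F i0 = h - (\<Sum>i\<in>J. ((h * u i) mod f i) * F i)"
        by (subst eq_diff_eq) (rule sumJ[symmetric])
      also have "degree \<dots> \<le> M"
      proof (intro degree_diff_le degree_sum_le h IJ)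
        fix i assume "i \<in> J"
        then have i: "i \<in> I" by (simp add: J_def)
        have "degree (((h * u i) mod f i) * F i) \<le> D + k * D"
          using degree_mult_le[of "(h * u i) mod f i" "F i"] degmod[OF i] degF[OF i] by linarith
        then show "degree (((h * u i) mod f i) * F i) \<le> M" using h by simp
      qed
      finally show ?thesis .
    qed
    \<comment> \<open>Cancel the degree \<open>k * D\<close> of \<open>F i0\<close>.\<close>
    then have "c0 = 0 \<or> degree c0 + k * D \<le> M"
      using F0 degF[OF i0] by (cases "c0 = 0") (auto simp: degree_mult_eq)
    then show ?thesis using True by (auto simp: c_def)
  next
    case False
    then show ?thesis using degmod[OF that] h by (simp add: c_def)
  qed
  have "h = (\<Sum>i\<in>I. c i * F i)"
  proof -
    have "(\<Sum>i\<in>J. c i * F i) = (\<Sum>i\<in>J. ((h * u i) mod f i) * F i)"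
      using IJ by (intro sum.cong) (auto simp: c_def)
    then have "(\<Sum>i\<in>I. c i * F i) = c0 * F i0 + (\<Sum>i\<in>J. ((h * u i) mod f i) * F i)"
      using IJ by (simp add: c_def)
    then show ?thesis by (rule trans[OF sumJ sym])
  qed
  then show ?thesis using degc unfolding F_def by blast
qed

section \<open>The dimension bound for common values\<close>

lemma sum_fun_apply: "(\<Sum>i\<in>A. F i) z = (\<Sum>i\<in>A. F i z)"
  for F :: "'i \<Rightarrow> 'z \<Rightarrow> 'a::comm_monoid_add"
  by (induction A rule: infinite_finite_induct) auto

text \<open>The point indicators of \<open>Z\<close>, each divided by \<open>g ^ card Z\<close>, all
  lie in the span of the \<open>(k * D + 1) ^ k\<close> monomials with exponents at most
  \<open>k * D\<close>, and they are independent.\<close>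

lemma card_common_value_le:
  fixes f :: "nat \<Rightarrow> nat \<Rightarrow> 'a::field poly" and x :: "nat \<Rightarrow> 'z \<Rightarrow> 'a" and g :: "'z \<Rightarrow> 'a"
  assumes Z: "finite Z" and k: "k > 0" and D: "D > 0"
    and deg: "\<And>i j. i \<le> k \<Longrightarrow> j < k \<Longrightarrow> degree (f i j) = D"
    and com: "\<And>i i' j. i \<le> k \<Longrightarrow> i' \<le> k \<Longrightarrow> i \<noteq> i' \<Longrightarrow> j < k \<Longrightarrow> \<exists>u v. u * f i j + v * f i' j = 1"
    and val: "\<And>i z. i \<le> k \<Longrightarrow> z \<in> Z \<Longrightarrow> (\<Prod>j<k. poly (f i j) (x j z)) = g z"
    and inj: "inj_on (x 0) Z"
  shows "card Z \<le> (k * D + 1) ^ k"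
proof -
  interpret V: vector_space "\<lambda>(c::'a) (h::'z \<Rightarrow> 'a) z. c * h z"
    by standard (auto simp: fun_eq_iff algebra_simps)
  define E where "E M = PiE {..<k} (\<lambda>_. {..M::nat})" for M
  \<comment> \<open>Functions are cut off to zero outside \<open>Z\<close>, so that identities valid
    on \<open>Z\<close> become equalities in the function space.\<close>
  define mon where "mon e z = (if z \<in> Z then \<Prod>j<k. x j z ^ e j else 0)" for e :: "nat \<Rightarrow> nat" and z
  define ev where "ev h z = (if z \<in> Z then \<Prod>j<k. poly (h j) (x j z) else 0)" for h z
  define W where "W M = V.span (mon ` E M)" for M
  have finE: "finite (E M)" for M unfolding E_def by (intro finite_PiE) auto
  have evW: "ev h \<in> W M" if h: "\<And>j. j < k \<Longrightarrow> degree (h j) \<le> M" for h M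
  proof -
    have "ev h = (\<Sum>e\<in>E M. (\<lambda>z. (\<Prod>j<k. coeff (h j) (e j)) * mon e z))"
    proof
      fix z
      show "ev h z = (\<Sum>e\<in>E M. (\<lambda>z. (\<Prod>j<k. coeff (h j) (e j)) * mon e z)) z"
      proof (cases "z \<in> Z")
        case True
        have "poly (h j) y = (\<Sum>a\<in>{..M}. coeff (h j) a * y ^ a)" if "j < k" for j y
          unfolding poly_altdef using h[OF that]
          by (intro sum.mono_neutral_left) (auto simp: coeff_eq_0)
        then have "ev h z = (\<Prod>j<k. \<Sum>a\<in>{..M}. coeff (h j) a * x j z ^ a)"
          using True by (simp add: ev_def)
        also have "\<dots> = (\<Sum>e\<in>E M. \<Prod>j<k. coeff (h j) (e j) * x j z ^ e j)"
          unfolding E_def by (subst prod_sum_PiE) auto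
        finally show ?thesis using True by (simp add: sum_fun_apply mon_def prod.distrib)
      qed (simp add: sum_fun_apply ev_def mon_def)
    qed
    also have "\<dots> \<in> W M"
      unfolding W_def by (intro V.span_sum V.span_scale V.span_base) auto
    finally show ?thesis .
  qed
  \<comment> \<open>\<open>\<mu> \<iota>\<close> is the index omitted by the selection \<open>\<iota>\<close>; all of its factors survive in the term of \<open>\<iota>\<close>.\<close>
  have fac: "\<exists>w\<in>W (N * D). mon e = (\<lambda>z. g z * w z)"
    if N: "k \<le> N" and e: "e \<in> E (Suc N * D)" for N e
  proof -
    \<comment> \<open>\<open>Q j c\<close> says that \<open>c\<close> lists the numerators of a
      partial fraction expansion of the \<open>j\<close>-th factor of the monomial
      \<open>e\<close>.\<close>
    define Q where "Q j c \<longleftrightarrow> monom 1 (e j) = (\<Sum>i\<in>{..k}. c i * (\<Prod>l\<in>{..k} - {i}. f l j)) \<and>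
        (\<forall>i\<in>{..k}. degree (c i) \<le> Suc N * D - k * D)" for j c
    have "\<exists>c. Q j c" if j: "j < k" for j
      unfolding Q_def
    proof (rule partial_fractions_degree)
      show "degree (monom (1::'a) (e j)) \<le> Suc N * D"
        using e j by (auto simp: E_def degree_monom_eq PiE_iff)
      show "Suc k * D \<le> Suc N * D" using N by (intro mult_right_mono) auto
      show "f i j \<noteq> 0" if "i \<in> {..k}" for i using deg[of i j] j D that by auto
    qed (use deg com j in auto)
    then obtain c where Qc: "\<And>j. j < k \<Longrightarrow> Q j (c j)" by metis
    have c: "monom 1 (e j) = (\<Sum>i\<in>{..k}. c j i * (\<Prod>l\<in>{..k} - {i}. f l j))" if "j < k" for j
      using Qc[OF that] by (simp add: Q_def)
    have degc: "degree (c j i) \<le> Suc N * D - k * D" if "j < k" "i \<le> k" for j i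
      using Qc[OF that(1)] that(2) by (simp add: Q_def)
    let ?S = "PiE {..<k} (\<lambda>_. {..k})"
    have "\<exists>i\<le>k. i \<notin> \<iota> ` {..<k}" for \<iota> :: "nat \<Rightarrow> nat"
    proof (rule ccontr)
      assume "\<not> (\<exists>i\<le>k. i \<notin> \<iota> ` {..<k})"
      then have "{..k} \<subseteq> \<iota> ` {..<k}" by auto
      then have "card {..k} \<le> card {..<k}" by (rule surj_card_le[rotated]) simp
      then show False by simp
    qed
    then obtain \<mu> :: "(nat \<Rightarrow> nat) \<Rightarrow> nat" where \<mu>: "\<And>\<iota>. \<mu> \<iota> \<le> k \<and> \<mu> \<iota> \<notin> \<iota> ` {..<k}" by metis
    define h where "h \<iota> j = c j (\<iota> j) * (\<Prod>l\<in>{..k} - {\<iota> j} - {\<mu> \<iota>}. f l j)" for \<iota> j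
    have fh: "c j (\<iota> j) * (\<Prod>l\<in>{..k} - {\<iota> j}. f l j) = f (\<mu> \<iota>) j * h \<iota> j" if "j < k" for \<iota> j
    proof -
      have "\<mu> \<iota> \<in> {..k} - {\<iota> j}" using \<mu>[of \<iota>] that by auto
      then show ?thesis by (simp add: h_def prod.remove[of "{..k} - {\<iota> j}" "\<mu> \<iota>"] mult_ac)
    qed
    have degh: "degree (h \<iota> j) \<le> N * D" if "\<iota> \<in> ?S" "j < k" for \<iota> j
    proof -
      have \<iota>: "\<iota> j \<le> k" "\<mu> \<iota> \<noteq> \<iota> j" "\<mu> \<iota> \<le> k" using that \<mu>[of \<iota>] by (auto simp: PiE_iff)
      have "degree (\<Prod>l\<in>{..k} - {\<iota> j} - {\<mu> \<iota>}. f l j) \<le> (\<Sum>l\<in>{..k} - {\<iota> j} - {\<mu> \<iota>}. degree (f l j))"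
        using degree_prod_sum_le[of "{..k} - {\<iota> j} - {\<mu> \<iota>}" "\<lambda>l. f l j"] by (simp add: comp_def)
      also have "\<dots> = (k - 1) * D" using deg that(2) \<iota> by simp
      \<comment> \<open>The numerator has degree at most \<open>(N + 1 - k) * D\<close>, and
        \<open>k - 1\<close> factors remain after removing the indices \<open>\<iota> j\<close> and
        \<open>\<mu> \<iota>\<close>. The truncated subtraction is exact because
        \<open>k \<le> N\<close>.\<close>
      finally have "degree (h \<iota> j) \<le> (Suc N * D - k * D) + (k - 1) * D"
        unfolding h_def using degc[OF that(2) \<iota>(1)] degree_mult_le
        by (meson add_mono order_trans)
      also have "\<dots> = (Suc N - k + (k - 1)) * D"
        by (simp only: diff_mult_distrib add_mult_distrib)
      also have "Suc N - k + (k - 1) = N" using N k by simp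
      finally show ?thesis .
    qed
    define w where "w = (\<Sum>\<iota>\<in>?S. ev (h \<iota>))"
    have "w \<in> W (N * D)"
      unfolding w_def W_def
      by (intro V.span_sum) (use evW degh in \<open>auto simp: W_def[symmetric]\<close>)
    moreover have "mon e z = g z * w z" for z
    proof (cases "z \<in> Z")
      case True
      have "mon e z = (\<Prod>j<k. poly (monom 1 (e j)) (x j z))"
        using True by (simp add: mon_def poly_monom)
      also have "\<dots> = (\<Prod>j<k. \<Sum>i\<in>{..k}. poly (c j i * (\<Prod>l\<in>{..k} - {i}. f l j)) (x j z))"
        by (intro prod.cong refl) (simp only: c lessThan_iff poly_sum)
      also have "\<dots> = (\<Sum>\<iota>\<in>?S. \<Prod>j<k. poly (c j (\<iota> j) * (\<Prod>l\<in>{..k} - {\<iota> j}. f l j)) (x j z))"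
        by (subst prod_sum_PiE) auto
      also have "\<dots> = (\<Sum>\<iota>\<in>?S. g z * ev (h \<iota>) z)"
      proof (rule sum.cong[OF refl])
        fix \<iota>
        have "(\<Prod>j<k. poly (c j (\<iota> j) * (\<Prod>l\<in>{..k} - {\<iota> j}. f l j)) (x j z))
            = (\<Prod>j<k. poly (f (\<mu> \<iota>) j) (x j z) * poly (h \<iota> j) (x j z))"
          by (intro prod.cong refl) (simp only: fh lessThan_iff poly_mult)
        also have "\<dots> = g z * ev (h \<iota>) z"
          using True \<mu>[of \<iota>] val by (simp add: prod.distrib ev_def)
        finally show "(\<Prod>j<k. poly (c j (\<iota> j) * (\<Prod>l\<in>{..k} - {\<iota> j}. f l j)) (x j z)) = g z * ev (h \<iota>) z" .
      qed
      finally show ?thesis by (simp add: w_def sum_fun_apply sum_distrib_left)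
    qed (simp add: w_def sum_fun_apply mon_def ev_def)
    ultimately show ?thesis by blast
  qed
  have lift: "\<exists>w'\<in>W (N * D). w = (\<lambda>z. g z * w' z)" if N: "k \<le> N" and w: "w \<in> W (Suc N * D)" for N w
  proof -
    \<comment> \<open>The multiples of \<open>g\<close> form a subspace, so \<open>fac\<close>
      extends from monomials to their span.\<close>
    let ?U = "{w. \<exists>w'\<in>W (N * D). w = (\<lambda>z. g z * w' z)}"
    have "V.subspace ?U"
    proof (rule V.subspaceI)
      show "0 \<in> ?U" using V.span_zero by (auto simp: W_def fun_eq_iff intro!: bexI[of _ 0])
    next
      fix a b assume "a \<in> ?U" "b \<in> ?U"
      then obtain a' b' where "a' \<in> W (N * D)" "a = (\<lambda>z. g z * a' z)" "b' \<in> W (N * D)" "b = (\<lambda>z. g z * b' z)"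
        by blast
      moreover from this have "a' + b' \<in> W (N * D)" unfolding W_def by (intro V.span_add)
      ultimately show "a + b \<in> ?U" by (auto simp: fun_eq_iff algebra_simps intro!: bexI[of _ "a' + b'"])
    next
      fix c a assume "a \<in> ?U"
      then obtain a' where "a' \<in> W (N * D)" "a = (\<lambda>z. g z * a' z)" by blast
      moreover from this have "(\<lambda>z. c * a' z) \<in> W (N * D)" unfolding W_def by (intro V.span_scale)
      ultimately show "(\<lambda>z. c * a z) \<in> ?U"
        by (auto simp: fun_eq_iff algebra_simps intro!: bexI[of _ "\<lambda>z. c * a' z"])
    qed
    then have "W (Suc N * D) \<subseteq> ?U"
      unfolding W_def[of "Suc N * D"] by (intro V.span_minimal) (use fac[OF N] in auto)
    then show ?thesis using w by blast
  qed
  have iter: "\<exists>w'\<in>W (k * D). \<forall>z. w z = g z ^ d * w' z" if "w \<in> W ((k + d) * D)" for w d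
    using that
  proof (induction d arbitrary: w)
    case 0
    then show ?case by auto
  next
    case (Suc d)
    then obtain w1 where "w1 \<in> W ((k + d) * D)" "w = (\<lambda>z. g z * w1 z)"
      using lift[of "k + d" w] by auto
    moreover then obtain w2 where "w2 \<in> W (k * D)" "\<forall>z. w1 z = g z ^ d * w2 z" using Suc.IH by blast
    ultimately show ?case by (intro bexI[of _ w2]) (auto simp: mult.assoc)
  qed
  have delta: "\<exists>w\<in>W (k * D). \<forall>z\<in>Z. g z ^ card Z * w z = of_bool (z = z0)" if z0: "z0 \<in> Z" for z0
  proof -
    define a where "a = (\<Prod>y\<in>Z - {z0}. x 0 z0 - x 0 y)"
    \<comment> \<open>The Lagrange polynomial in the variable \<open>x 0\<close> that singles out
      \<open>z0\<close>. Its degree is below \<open>card Z\<close>, so \<open>card Z\<close>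
      divisions by \<open>g\<close> bring it down to \<open>W (k * D)\<close>.\<close>
    define h where "h j = (if j = 0 then smult (inverse a) (\<Prod>y\<in>Z - {z0}. [:- x 0 y, 1:]) else 1)" for j :: nat
    have a: "a \<noteq> 0" unfolding a_def using Z inj z0 by (auto simp: inj_on_def)
    have "degree (h j) \<le> (k + card Z) * D" for j
    proof (cases "j = 0")
      case True
      have "degree (\<Prod>y\<in>Z - {z0}. [:- x 0 y, 1:]) \<le> (\<Sum>y\<in>Z - {z0}. degree [:- x 0 y, 1:])"
        using degree_prod_sum_le[of "Z - {z0}" "\<lambda>y. [:- x 0 y, 1:]"] Z by (simp add: comp_def)
      also have "\<dots> \<le> card Z" using Z z0 by simp
      also have "\<dots> \<le> (k + card Z) * D" using D by (cases D) auto
      finally show ?thesis using True by (simp add: h_def)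
    qed (simp add: h_def)
    then have "ev h \<in> W ((k + card Z) * D)" by (rule evW)
    then obtain w where w: "w \<in> W (k * D)" "\<forall>z. ev h z = g z ^ card Z * w z" using iter by blast
    have "ev h z = of_bool (z = z0)" if "z \<in> Z" for z
    proof -
      have "ev h z = poly (h 0) (x 0 z)"
        unfolding ev_def using that k by (simp add: prod.remove[of "{..<k}" 0] h_def)
      also have "\<dots> = of_bool (z = z0)"
        using Z that a by (auto simp: h_def poly_prod a_def)
      finally show ?thesis .
    qed
    then have "\<forall>z\<in>Z. g z ^ card Z * w z = of_bool (z = z0)" using w(2) by metis
    then show ?thesis using w(1) by blast
  qed
  then obtain w where wW: "\<And>z0. z0 \<in> Z \<Longrightarrow> w z0 \<in> W (k * D)"
    and w: "\<And>z0 z. z0 \<in> Z \<Longrightarrow> z \<in> Z \<Longrightarrow> g z ^ card Z * w z0 z = of_bool (z = z0)" by metis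
  \<comment> \<open>The value 1 at the diagonal makes both factors nonzero; in particular
    \<open>g\<close> vanishes nowhere on \<open>Z\<close>, so \<open>w z0\<close> vanishes exactly
    off \<open>z0\<close> within \<open>Z\<close>.\<close>
  have g0: "g z ^ card Z \<noteq> 0" "w z z \<noteq> 0" if "z \<in> Z" for z
    using w[OF that that] by (auto simp del: power_eq_0_iff)
  have w0: "w z0 z = 0" if "z0 \<in> Z" "z \<in> Z" "z \<noteq> z0" for z0 z
    using w[OF that(1,2)] g0[OF that(2)] that(3) by auto
  have injw: "inj_on w Z"
  proof (rule inj_onI)
    fix y z assume "y \<in> Z" "z \<in> Z" "w y = w z"
    then show "y = z" using w0[of y z] g0(2)[of z] by auto
  qed
  have "V.independent (w ` Z)"
  proof
    assume "V.dependent (w ` Z)"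
    then obtain T u where T: "finite T" "T \<subseteq> w ` Z" "(\<Sum>v\<in>T. (\<lambda>z. u v * v z)) = 0" "\<exists>v\<in>T. u v \<noteq> 0"
      unfolding V.dependent_explicit by blast
    then obtain z where z: "z \<in> Z" "w z \<in> T" "u (w z) \<noteq> 0" by auto
    have "0 = (\<Sum>v\<in>T. (\<lambda>z. u v * v z)) z" by (simp add: T)
    also have "\<dots> = (\<Sum>v\<in>T. u v * v z)" by (simp add: sum_fun_apply)
    also have "\<dots> = (\<Sum>v\<in>{w z}. u v * v z)"
      using T z w0 by (intro sum.mono_neutral_right) auto
    finally show False using z g0 by simp
  qed
  moreover have "w ` Z \<subseteq> V.span (mon ` E (k * D))" using wW by (auto simp: W_def)
  ultimately have "card (w ` Z) \<le> card (mon ` E (k * D))"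
    using V.independent_span_bound finE by blast
  also have "\<dots> \<le> card (E (k * D))" using finE by (rule card_image_le)
  also have "\<dots> = (k * D + 1) ^ k" by (simp add: E_def card_PiE)
  finally show ?thesis using injw by (simp add: card_image)
qed

section \<open>Norm sets over finite fields\<close>

lemma frobenius_diff:
  fixes x y :: "'a::comm_ring_1"
  assumes "prime CHAR('a)" "m = CHAR('a) ^ n"
  shows "(x - y) ^ m = x ^ m - y ^ m"
  using freshmans_dream'[OF assms, of "x - y" y] by simp

lemma frobenius_inj:
  fixes x y :: "'a::idom"
  assumes "prime CHAR('a)" "m = CHAR('a) ^ n" "x ^ m = y ^ m"
  shows "x = y"
proof -
  have "(x - y) ^ m = 0" using frobenius_diff[OF assms(1,2), of x y] assms(3) by simp
  then show ?thesis by simp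
qed

text \<open>The fixed points are the roots of \<open>X ^ m - X\<close>, which splits and has
  derivative -1, so all \<open>m\<close> roots are simple.\<close>

lemma card_frobenius_fixed:
  assumes "prime CHAR('a::alg_closed_field)" "m = CHAR('a) ^ n" "n > 0"
  shows "card {x::'a. x ^ m = x} = m"
proof -
  let ?P = "monom 1 m - monom 1 1 :: 'a poly"
  have "CHAR('a) > 1" using assms(1) by (rule prime_gt_1_nat)
  then have m: "m > 1" unfolding assms(2) using assms(3) by (rule one_less_power)
  have deg: "degree ?P = m"
    using m degree_add_eq_left[of "- monom 1 1" "monom (1::'a) m"] by (simp add: degree_monom_eq)
  have lc: "lead_coeff ?P = 1" unfolding deg using m by simp
  have "?P \<noteq> 0" using lc by (metis leading_coeff_0_iff zero_neq_one)
  then obtain A where "size A = degree ?P" "?P = Polynomial.smult (lead_coeff ?P) (\<Prod>x\<in>#A. [:-x, 1:])"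
    using alg_closed_imp_factorization by blast
  then have A: "size A = m" "?P = (\<Prod>x\<in>#A. [:-x, 1:])"
    by (simp_all only: deg lc[unfolded deg] smult_1_left)
  have "of_nat m = (0::'a)" using assms(2,3) by simp
  then have der: "pderiv ?P = -1"
    by (simp add: pderiv_diff pderiv_monom one_pCons monom_0)
  have "count A a \<le> 1" for a
  proof (rule ccontr)
    assume "\<not> count A a \<le> 1"
    then have "{#a, a#} \<subseteq># A" by (auto simp: subseteq_mset_def)
    then obtain B where "A = {#a, a#} + B" by (auto simp: mset_subset_eq_exists_conv)
    then have "?P = [:-a, 1:] * ([:-a, 1:] * (\<Prod>x\<in>#B. [:-x, 1:]))" using A by simp
    then have "poly (pderiv ?P) a = 0"
      by (simp only: pderiv_mult poly_add poly_mult) simp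
    then show False unfolding der by simp
  qed
  then have "A = mset_set (set_mset A)"
    by (intro multiset_eqI) (simp add: count_mset_set' not_in_iff order_antisym Suc_le_eq)
  then have "card (set_mset A) = m" using A(1) by (metis size_mset_set)
  moreover have "set_mset A = {x. poly ?P x = 0}"
    unfolding A(2) by (auto simp: poly_prod_mset prod_mset_zero_iff)
  ultimately show ?thesis by (simp add: poly_monom)
qed

text \<open>One representative is kept per orbit. Orbits have at most \<open>D\<close> elements, and
  since \<open>\<phi>\<close> acts invertibly on each of them, two orbits that meet
  coincide.\<close>

lemma orbit_representatives:
  fixes \<phi> :: "'a \<Rightarrow> 'a"
  assumes S: "finite S" "\<And>x. x \<in> S \<Longrightarrow> (\<phi> ^^ D) x = x" and D: "D > 0"
  obtains A where "A \<subseteq> S" "card S \<le> card A * D"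
    and "\<And>x y i j. x \<in> A \<Longrightarrow> y \<in> A \<Longrightarrow> x \<noteq> y \<Longrightarrow> (\<phi> ^^ i) x \<noteq> (\<phi> ^^ j) y"
proof -
  define orb where "orb x = range (\<lambda>l. (\<phi> ^^ l) x)" for x
  have orb_card: "finite (orb x) \<and> card (orb x) \<le> D" if "x \<in> S" for x
  proof -
    have "orb x \<subseteq> (\<lambda>l. (\<phi> ^^ l) x) ` {..<D}"
    proof
      fix y assume "y \<in> orb x"
      then obtain l where "y = (\<phi> ^^ l) x" by (auto simp: orb_def)
      then have "y = (\<phi> ^^ (l mod D)) x" using funpow_mod_eq[of D \<phi> x l] S(2)[OF that] by simp
      then show "y \<in> (\<lambda>l. (\<phi> ^^ l) x) ` {..<D}" using D by auto
    qed
    then show ?thesis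
      by (metis card_image_le card_lessThan card_mono finite_imageI finite_lessThan finite_subset order_trans)
  qed
  have orb_eq: "orb ((\<phi> ^^ i) x) = orb x" if "x \<in> S" for x i
  proof
    show "orb ((\<phi> ^^ i) x) \<subseteq> orb x"
      by (auto simp: orb_def funpow_add[symmetric, THEN fun_cong, unfolded comp_def])
    \<comment> \<open>On the orbit of \<open>x\<close>, the inverse of \<open>\<phi> ^^ i\<close> is
      \<open>\<phi> ^^ (i * (D - 1))\<close>.\<close>
    have "(\<phi> ^^ (i * (D - 1) + i)) x = (\<phi> ^^ ((i * (D - 1) + i) mod D)) x"
      using funpow_mod_eq[of D \<phi> x] S(2)[OF that] by simp
    also have "i * (D - 1) + i = i * D" using D by (cases D) auto
    finally have "x = (\<phi> ^^ (i * (D - 1))) ((\<phi> ^^ i) x)"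
      using \<open>i * (D - 1) + i = i * D\<close> by (metis comp_apply funpow_add mod_mult_self2_is_0 funpow_0)
    then have eq: "(\<phi> ^^ l) x = (\<phi> ^^ (l + i * (D - 1))) ((\<phi> ^^ i) x)" for l
      by (metis comp_apply funpow_add)
    show "orb x \<subseteq> orb ((\<phi> ^^ i) x)"
      unfolding orb_def by (intro image_subsetI) (rule range_eqI, rule eq)
  qed
  define A where "A = inv_into S orb ` orb ` S"
  have A: "A \<subseteq> S" unfolding A_def by (auto intro: inv_into_into)
  have "card A = card (orb ` S)"
    unfolding A_def by (intro card_image inj_on_inv_into) auto
  have "x \<in> orb x" for x unfolding orb_def by (rule range_eqI[of _ _ 0]) simp
  then have "S \<subseteq> \<Union> (orb ` S)" by blast
  then have "card S \<le> card (\<Union> (orb ` S))"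
    using S(1) orb_card by (intro card_mono) auto
  also have "\<dots> \<le> (\<Sum>B\<in>orb ` S. card B)"
    using S(1) card_UN_le[of "orb ` S" id] by simp
  also have "\<dots> \<le> (\<Sum>B\<in>orb ` S. D)" using orb_card by (intro sum_mono) auto
  finally have "card S \<le> card A * D" using \<open>card A = card (orb ` S)\<close> by simp
  moreover have "(\<phi> ^^ i) x \<noteq> (\<phi> ^^ j) y" if xy: "x \<in> A" "y \<in> A" "x \<noteq> y" for x y i j
  proof
    assume "(\<phi> ^^ i) x = (\<phi> ^^ j) y"
    then have "orb x = orb y" using orb_eq xy A by (metis subsetD)
    moreover have "inv_into S orb (orb z) = z" if "z \<in> A" for z
      using that by (auto simp: A_def f_inv_into_f)
    ultimately show False using xy by metis
  qed
  ultimately show ?thesis using A that by blast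
qed

section \<open>Norms as products of twisted conjugate polynomials\<close>

text \<open>The \<open>j\<close>-th Frobenius twist, by \<open>x \<mapsto> x ^ q ^ j\<close>, of the product of \<open>X - \<beta>\<close> over the orbit of
  \<open>\<alpha>\<close> under \<open>x \<mapsto> x ^ q ^ k\<close>.\<close>

definition conj_poly :: "nat \<Rightarrow> nat \<Rightarrow> nat \<Rightarrow> 'a::field \<Rightarrow> nat \<Rightarrow> 'a poly" where
  "conj_poly q k D \<alpha> j = (\<Prod>l<D. [:- (\<alpha> ^ q ^ (l * k + j)), 1:])"

lemma degree_conj_poly [simp]: "degree (conj_poly q k D \<alpha> j) = D"
  unfolding conj_poly_def by (subst degree_prod_sum_eq) auto

lemma lead_coeff_conj_poly [simp]: "coeff (conj_poly q k D \<alpha> j) D = 1"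
proof -
  have "lead_coeff (conj_poly q k D \<alpha> j) = 1"
    unfolding conj_poly_def by (simp add: lead_coeff_prod)
  then show ?thesis by simp
qed

lemma poly_conj_poly: "poly (conj_poly q k D \<alpha> j) x = (\<Prod>l<D. x - \<alpha> ^ q ^ (l * k + j))"
  by (simp add: conj_poly_def poly_prod)

text \<open>The exponent is that of the norm from the field with \<open>q ^ n\<close> elements to
  the one with \<open>q\<close>; raising to the \<open>q\<close>-th power only replaces the factor
  \<open>z\<close> by \<open>z ^ q ^ n\<close>, which equals \<open>z\<close>.\<close>

lemma norm_fixed:
  fixes z :: "'a::field"
  assumes "z ^ q ^ n = z" "n > 0" "q > 0"
  shows "(z ^ (\<Sum>i<n. q ^ i)) ^ q = z ^ (\<Sum>i<n. q ^ i)"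
proof (cases "z = 0")
  case True
  have "(\<Sum>i<n. q ^ i) > 0" using assms by (intro sum_pos) auto
  then have "z ^ (\<Sum>i<n. q ^ i) = 0" unfolding True by (rule zero_power)
  then show ?thesis using zero_power[OF assms(3)] by metis
next
  case False
  have "(\<Sum>i<n. q ^ i) * q + 1 = (\<Sum>i<Suc n. q ^ i)"
    by (simp only: sum.lessThan_Suc_shift) (simp add: sum_distrib_left mult.commute)
  then have "(\<Sum>i<n. q ^ i) * q + 1 = (\<Sum>i<n. q ^ i) + q ^ n" by simp
  then have "z ^ ((\<Sum>i<n. q ^ i) * q) * z = z ^ (\<Sum>i<n. q ^ i) * z ^ q ^ n"
    by (metis power_add power_one_right)
  then show ?thesis using False assms(1) by (simp add: power_mult)
qed

text \<open>Write the exponents \<open>i < D * k\<close> as \<open>l * k + j\<close> and apply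
  Frobenius to \<open>x - \<alpha>\<close>. As \<open>x\<close> is fixed by the power
  \<open>q ^ k\<close>, only \<open>j\<close> affects the image of \<open>x\<close>, and collecting
  the factors with equal \<open>j\<close> gives the twists.\<close>

lemma norm_eq_prod_conj_poly:
  fixes x \<alpha> :: "'a::field"
  assumes p: "prime CHAR('a)" "q = CHAR('a) ^ e" and x: "x ^ q ^ k = x"
  shows "(x - \<alpha>) ^ (\<Sum>i<D * k. q ^ i) = (\<Prod>j<k. poly (conj_poly q k D \<alpha> j) (x ^ q ^ j))"
proof -
  have xl: "x ^ q ^ (l * k) = x" for l
  proof (induction l)
    case (Suc l)
    have "x ^ q ^ (Suc l * k) = (x ^ q ^ k) ^ q ^ (l * k)"
      by (simp add: power_add power_mult)
    then show ?case using Suc x by simp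
  qed simp
  have fr: "(x - \<alpha>) ^ q ^ (l * k + j) = x ^ q ^ j - \<alpha> ^ q ^ (l * k + j)" for l j
  proof -
    have "(x - \<alpha>) ^ q ^ (l * k + j) = x ^ q ^ (l * k + j) - \<alpha> ^ q ^ (l * k + j)"
      by (rule frobenius_diff[OF p(1), of _ "e * (l * k + j)"]) (simp add: p(2) power_mult)
    also have "x ^ q ^ (l * k + j) = (x ^ q ^ (l * k)) ^ q ^ j"
      by (simp add: power_add power_mult)
    finally show ?thesis by (simp add: xl)
  qed
  have "(\<Sum>i<D * k. q ^ i) = (\<Sum>l<D. \<Sum>i\<in>{l * k..<l * k + k}. q ^ i)"
    by (simp add: sum.nat_group)
  also have "\<dots> = (\<Sum>l<D. \<Sum>j<k. q ^ (l * k + j))"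
    by (subst sum.atLeastLessThan_shift_0) (simp add: atLeast0LessThan)
  finally have "(x - \<alpha>) ^ (\<Sum>i<D * k. q ^ i) = (\<Prod>l<D. \<Prod>j<k. (x - \<alpha>) ^ q ^ (l * k + j))"
    by (simp add: power_sum)
  also have "\<dots> = (\<Prod>j<k. \<Prod>l<D. x ^ q ^ j - \<alpha> ^ q ^ (l * k + j))"
    by (subst prod.swap) (simp add: fr)
  finally show ?thesis by (simp add: poly_conj_poly)
qed

lemma comaximal_linear:
  fixes a b :: "'a::field"
  assumes "a \<noteq> b"
  shows "\<exists>u v. u * [:- a, 1:] + v * [:- b, 1:] = 1"
proof (intro exI)
  have "inverse (b - a) * (b - a) = 1" using assms by simp
  then show "[:inverse (b - a):] * [:- a, 1:] + [:- inverse (b - a):] * [:- b, 1:] = 1"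
    by (simp add: one_pCons algebra_simps)
qed

text \<open>Injectivity of Frobenius keeps the two orbits disjoint after the \<open>j\<close>-th
  twist, so the linear factors are pairwise comaximal; multiplying them up, first over one orbit and
  then over the other, gives the claim.\<close>

lemma comaximal_conj_poly:
  fixes \<alpha> \<beta> :: "'a::field"
  assumes p: "prime CHAR('a)" "q = CHAR('a) ^ e"
    and ne: "\<And>i j. \<alpha> ^ (q ^ k) ^ i \<noteq> \<beta> ^ (q ^ k) ^ j"
  shows "\<exists>u v. u * conj_poly q k D \<alpha> j + v * conj_poly q k D \<beta> j = 1"
proof -
  have ne': "\<alpha> ^ q ^ (i * k + j) \<noteq> \<beta> ^ q ^ (l * k + j)" for i l
  proof
    assume "\<alpha> ^ q ^ (i * k + j) = \<beta> ^ q ^ (l * k + j)"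
    then have "(\<alpha> ^ (q ^ k) ^ i) ^ q ^ j = (\<beta> ^ (q ^ k) ^ l) ^ q ^ j"
      by (simp add: power_add power_mult mult.commute[of _ k])
    then have "\<alpha> ^ (q ^ k) ^ i = \<beta> ^ (q ^ k) ^ l"
      by (rule frobenius_inj[OF p(1), of _ "e * j", rotated]) (simp add: p(2) power_mult)
    then show False using ne by blast
  qed
  have "\<exists>u v. u * [:- (\<alpha> ^ q ^ (i * k + j)), 1:] + v * conj_poly q k D \<beta> j = 1" for i
    unfolding conj_poly_def by (intro comaximal_prod finite_lessThan comaximal_linear ne')
  then have "\<exists>v u. v * conj_poly q k D \<beta> j + u * [:- (\<alpha> ^ q ^ (i * k + j)), 1:] = 1" for i
    by (metis add.commute)
  then have "\<exists>v u. v * conj_poly q k D \<beta> j + u * conj_poly q k D \<alpha> j = 1"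
    unfolding conj_poly_def[of q k D \<alpha>] by (intro comaximal_prod finite_lessThan)
  then show ?thesis by (metis add.commute)
qed

text \<open>The values \<open>x ^ q ^ j\<close> serve as the \<open>k\<close> variables; the one
  with \<open>j = 0\<close> is \<open>x\<close> itself and separates points.\<close>

lemma card_common_norm_le:
  fixes P Z :: "'a::field set"
  assumes p: "prime CHAR('a)" "q = CHAR('a) ^ e" and k: "k > 0" and D: "D > 0"
    and P: "card P = k + 1"
    and ne: "\<And>\<alpha> \<beta> i j. \<alpha> \<in> P \<Longrightarrow> \<beta> \<in> P \<Longrightarrow> \<alpha> \<noteq> \<beta> \<Longrightarrow> \<alpha> ^ (q ^ k) ^ i \<noteq> \<beta> ^ (q ^ k) ^ j"
    and Z: "finite Z" "\<And>x. x \<in> Z \<Longrightarrow> x ^ q ^ k = x"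
    and g: "\<And>x \<alpha>. x \<in> Z \<Longrightarrow> \<alpha> \<in> P \<Longrightarrow> (x - \<alpha>) ^ (\<Sum>i<D * k. q ^ i) = g x"
  shows "card Z \<le> (k * D + 1) ^ k"
proof -
  have "finite P" using P by (metis Suc_eq_plus1 card.infinite nat.distinct(1))
  then obtain b where b: "bij_betw b {0..<k + 1} P"
    using ex_bij_betw_nat_finite[of P] P by auto
  have bP: "b i \<in> P" if "i \<le> k" for i using bij_betwE[OF b] that by auto
  have bne: "b i \<noteq> b i'" if "i \<le> k" "i' \<le> k" "i \<noteq> i'" for i i'
    using bij_betw_imp_inj_on[OF b] that by (auto simp: inj_on_def)
  show ?thesis
  proof (rule card_common_value_le[where f = "\<lambda>i j. conj_poly q k D (b i) j" and x = "\<lambda>j x. x ^ q ^ j" and g = g])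
    show "\<exists>u v. u * conj_poly q k D (b i) j + v * conj_poly q k D (b i') j = 1"
      if "i \<le> k" "i' \<le> k" "i \<noteq> i'" "j < k" for i i' j
      by (rule comaximal_conj_poly[OF p]) (use ne bP bne that in auto)
    show "(\<Prod>j<k. poly (conj_poly q k D (b i) j) (x ^ q ^ j)) = g x" if "i \<le> k" "x \<in> Z" for i x
      using norm_eq_prod_conj_poly[OF p Z(2)[OF that(2)]] g[OF that(2) bP[OF that(1)]] by simp
  qed (use Z k D in auto)
qed

text \<open>For \<open>k = 1\<close> the previous bound \<open>D + 1\<close> is too weak to allow \<open>D = t\<close>, which is then needed.\<close>

lemma card_common_norm_less:
  fixes \<alpha> \<beta> :: "'a::field"
  assumes p: "prime CHAR('a)" "q = CHAR('a) ^ e" and D: "D > 0"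
    and ne: "\<And>i j. \<alpha> ^ q ^ i \<noteq> \<beta> ^ q ^ j"
    and Z: "\<And>x. x \<in> Z \<Longrightarrow> x ^ q = x"
    and g: "\<And>x. x \<in> Z \<Longrightarrow> (x - \<alpha>) ^ (\<Sum>i<D. q ^ i) = (x - \<beta>) ^ (\<Sum>i<D. q ^ i)"
  shows "card Z < D"
proof -
  \<comment> \<open>Both polynomials are monic of degree \<open>D\<close>, so the difference has
    smaller degree; it is nonzero because \<open>\<beta>\<close> is a root of only one of
    them.\<close>
  let ?d = "conj_poly q 1 D \<alpha> 0 - conj_poly q 1 D \<beta> 0"
  have "poly (conj_poly q 1 D \<beta> 0) \<beta> = 0" using D by (auto simp: poly_conj_poly intro!: bexI[of _ 0])
  moreover have "poly (conj_poly q 1 D \<alpha> 0) \<beta> \<noteq> 0"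
    using ne[of _ 0] by (auto simp: poly_conj_poly eq_commute[of \<beta>])
  ultimately have d0: "?d \<noteq> 0" by auto
  have "degree ?d \<le> D" by (intro degree_diff_le) auto
  moreover have "degree ?d \<noteq> D"
  proof
    assume "degree ?d = D"
    then have "lead_coeff ?d = 0" by simp
    then show False using d0 by (simp only: leading_coeff_0_iff)
  qed
  ultimately have deg: "degree ?d < D" by simp
  have "Z \<subseteq> {x. poly ?d x = 0}"
  proof
    fix x assume x: "x \<in> Z"
    then have "x ^ q ^ 1 = x" using Z by simp
    then show "x \<in> {x. poly ?d x = 0}"
      using norm_eq_prod_conj_poly[OF p, of x 1 _ D] g[OF x] by simp
  qed
  then have "card Z \<le> card {x. poly ?d x = 0}"
    using poly_roots_finite[OF d0] by (rule card_mono[rotated])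
  also have "\<dots> \<le> degree ?d" using d0 by (rule card_poly_roots_bound)
  finally show ?thesis using deg by simp
qed

section \<open>The set family from norm graphs in characteristic 2\<close>

lemma CHAR_bit: "CHAR(bit) = 2"
proof -
  have "(of_nat n :: bit) = (if even n then 0 else 1)" for n
    by (induction n) auto
  then show ?thesis by (intro CHAR_eqI) (auto split: if_splits)
qed

text \<open>All fields involved are sets of Frobenius-fixed points in the algebraic closure of the
  field with two elements. The number \<open>a\<close> of sets is the number of orbit
  representatives, hence the loss of a factor \<open>D\<close>.\<close>

lemma algebraic_set_family:
  fixes q k D e :: nat
  assumes q: "q = 2 ^ e" "e > 0" and k: "k > 0" and D: "D > 0"
  shows "\<exists>(a::nat) (A :: nat \<Rightarrow> nat set). q ^ (D * k) \<le> a * D \<and>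
    (\<forall>i<a. A i \<subseteq> {..<q ^ Suc k} \<and> card (A i) = q ^ k) \<and>
    (\<forall>P\<subseteq>{..<a}. card P = Suc k \<longrightarrow>
       card (\<Inter>i\<in>P. A i) \<le> (k * D + 1) ^ k \<and> (k = 1 \<longrightarrow> card (\<Inter>i\<in>P. A i) < D))"
proof -
  have p: "prime CHAR(bit alg_closure)" by (simp add: CHAR_bit)
  have qc: "q = CHAR(bit alg_closure) ^ e" by (simp add: CHAR_bit q)
  have q0: "q > 1" unfolding q(1) using q(2) by (intro one_less_power) auto
  define F :: "nat \<Rightarrow> bit alg_closure set" where "F j = {x. x ^ q ^ j = x}" for j
  have cardF: "card (F j) = q ^ j" if "j > 0" for j
    unfolding F_def by (rule card_frobenius_fixed[OF p, of _ "e * j"])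
      (use that q(2) in \<open>simp_all add: qc power_mult\<close>)
  have finF: "finite (F j)" if "j > 0" for j
    using cardF[OF that] q0 by (metis card.infinite power_not_zero not_one_less_zero)
  define E where "E = (\<Sum>i<D * k. q ^ i)"
  define \<phi> :: "bit alg_closure \<Rightarrow> bit alg_closure" where "\<phi> x = x ^ q ^ k" for x
  have \<phi>: "(\<phi> ^^ l) x = x ^ (q ^ k) ^ l" for l x
    by (induction l) (simp_all add: \<phi>_def power_mult[symmetric] mult.commute)
  have Dk: "D * k > 0" using D k by simp
  obtain B where B: "B \<subseteq> F (D * k)" "card (F (D * k)) \<le> card B * D"
    and ne: "\<And>x y i j. x \<in> B \<Longrightarrow> y \<in> B \<Longrightarrow> x \<noteq> y \<Longrightarrow> x ^ (q ^ k) ^ i \<noteq> y ^ (q ^ k) ^ j"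
    using orbit_representatives[where S = "F (D * k)" and \<phi> = \<phi> and D = D] finF[OF Dk] D
    unfolding \<phi> by (auto simp: F_def power_mult[symmetric] mult.commute)
  have finB: "finite B" using B(1) finF[OF Dk] by (rule finite_subset)
  define S where "S \<alpha> = (\<lambda>x. (x, (x - \<alpha>) ^ E)) ` F k" for \<alpha>
  have FF: "x \<in> F (D * k)" if "x \<in> F k" for x
  proof -
    have "(\<phi> ^^ l) x = x" for l by (induction l) (use that in \<open>simp_all add: \<phi>_def F_def\<close>)
    then show ?thesis by (simp add: \<phi> F_def power_mult[symmetric] mult.commute)
  qed
  have Ssub: "S \<alpha> \<subseteq> F k \<times> F 1" if "\<alpha> \<in> B" for \<alpha>
  proof -
    have "((x - \<alpha>) ^ E) ^ q = (x - \<alpha>) ^ E" if "x \<in> F k" for x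
    proof -
      have "(x - \<alpha>) ^ q ^ (D * k) = x ^ q ^ (D * k) - \<alpha> ^ q ^ (D * k)"
        by (rule frobenius_diff[OF p, of _ "e * (D * k)"]) (simp add: qc power_mult)
      then have "(x - \<alpha>) ^ q ^ (D * k) = x - \<alpha>"
        using FF[OF that] \<open>\<alpha> \<in> B\<close> B(1) by (auto simp: F_def)
      then show ?thesis unfolding E_def using Dk q0 by (intro norm_fixed) auto
    qed
    then show ?thesis by (auto simp: S_def F_def)
  qed
  have cardS: "card (S \<alpha>) = q ^ k" for \<alpha>
    unfolding S_def by (subst card_image) (auto simp: inj_on_def cardF[OF k])
  have bound: "card (\<Inter>\<alpha>\<in>P. S \<alpha>) \<le> (k * D + 1) ^ k \<and> (k = 1 \<longrightarrow> card (\<Inter>\<alpha>\<in>P. S \<alpha>) < D)"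
    if P: "P \<subseteq> B" "card P = Suc k" for P
  proof -
    define I where "I = (\<Inter>\<alpha>\<in>P. S \<alpha>)"
    obtain \<alpha>0 where \<alpha>0: "\<alpha>0 \<in> P" using P(2) by fastforce
    \<comment> \<open>Each set is the graph of a function, so the intersection can be counted by
      first coordinates.\<close>
    have "inj_on fst I"
      using \<alpha>0 by (auto simp: inj_on_def I_def S_def dest!: bspec)
    then have cI: "card I = card (fst ` I)" by (simp add: card_image)
    have Z: "x ^ q ^ k = x" if "x \<in> fst ` I" for x
      using that \<alpha>0 by (auto simp: I_def S_def F_def)
    have "fst ` I \<subseteq> F k" using Z by (auto simp: F_def)
    then have finZ: "finite (fst ` I)" using finF[OF k] by (rule finite_subset)
    have val: "(x - \<alpha>) ^ E = (x - \<alpha>0) ^ E" if x: "x \<in> fst ` I" and \<alpha>: "\<alpha> \<in> P" for x \<alpha>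
    proof -
      obtain y where "(x, y) \<in> I" using x by force
      then have "(x, y) \<in> S \<alpha>" "(x, y) \<in> S \<alpha>0" using \<alpha> \<alpha>0 by (auto simp: I_def)
      then show ?thesis by (auto simp: S_def)
    qed
    have "x ^ (q ^ k) ^ i \<noteq> y ^ (q ^ k) ^ j" if "x \<in> P" "y \<in> P" "x \<noteq> y" for x y i j
      using ne P(1) that by blast
    then have "card (fst ` I) \<le> (k * D + 1) ^ k"
      using P Z finZ val k D
      by (intro card_common_norm_le[OF p qc, of k D P "fst ` I" "\<lambda>x. (x - \<alpha>0) ^ E"])
        (auto simp: E_def)
    moreover have "card (fst ` I) < D" if "k = 1"
    proof -
      have "card (P - {\<alpha>0}) = 1" using P(2) \<alpha>0 that by simp
      then obtain \<beta> where \<beta>: "P - {\<alpha>0} = {\<beta>}" by (auto simp: card_1_singleton_iff)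
      then have "\<beta> \<in> P" "\<beta> \<noteq> \<alpha>0" by auto
      then show ?thesis
        using that ne[of \<beta> \<alpha>0] P(1) \<alpha>0 Z val[of _ \<beta>] D
        by (intro card_common_norm_less[OF p qc, of D \<beta> \<alpha>0]) (auto simp: E_def)
    qed
    ultimately show ?thesis using cI by (simp add: I_def)
  qed
  define U where "U = F k \<times> F 1"
  have U: "finite U" "card U = q ^ Suc k"
    using finF[OF k] finF[of 1] cardF[OF k] cardF[of 1] by (simp_all add: U_def card_cartesian_product)
  \<comment> \<open>Number the points of \<open>U\<close> and the representatives, to obtain sets of
    naturals indexed by naturals.\<close>
  obtain h where h: "bij_betw h U {0..<q ^ Suc k}"
    using ex_bij_betw_finite_nat[OF U(1)] U(2) by auto
  obtain b where b: "bij_betw b {0..<card B} B"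
    using ex_bij_betw_nat_finite[OF finB] by blast
  have bB: "b i \<in> B" if "i < card B" for i using bij_betwE[OF b] that by auto
  define A where "A i = h ` S (b i)" for i
  have hinj: "inj_on h U" using h by (rule bij_betw_imp_inj_on)
  have SU: "S (b i) \<subseteq> U" if "i < card B" for i using Ssub bB that by (simp add: U_def)
  have "q ^ (D * k) \<le> card B * D" using B(2) cardF[OF Dk] by simp
  moreover have "A i \<subseteq> {..<q ^ Suc k}" if "i < card B" for i
    using bij_betw_imp_surj_on[OF h] SU[OF that] unfolding A_def by (auto simp: atLeast0LessThan)
  moreover have "card (A i) = q ^ k" if "i < card B" for i
    unfolding A_def using card_image[OF inj_on_subset[OF hinj SU[OF that]]] cardS by simp
  moreover have "card (\<Inter>i\<in>P. A i) \<le> (k * D + 1) ^ k \<and> (k = 1 \<longrightarrow> card (\<Inter>i\<in>P. A i) < D)"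
    if P: "P \<subseteq> {..<card B}" "card P = Suc k" for P
  proof -
    obtain i0 where i0: "i0 \<in> P" using P(2) by fastforce
    have "(\<Inter>i\<in>P. A i) = h ` (\<Inter>i\<in>P. S (b i))"
      unfolding A_def by (rule image_INT[OF hinj _ i0, symmetric]) (use SU P(1) in auto)
    moreover have "(\<Inter>i\<in>P. S (b i)) \<subseteq> U" using SU[of i0] i0 P(1) by auto
    then have "inj_on h (\<Inter>i\<in>P. S (b i))" by (rule inj_on_subset[OF hinj])
    ultimately have "card (\<Inter>i\<in>P. A i) = card (\<Inter>\<alpha>\<in>b ` P. S \<alpha>)"
      by (simp add: card_image)
    moreover have "inj_on b P"
      by (rule inj_on_subset[OF bij_betw_imp_inj_on[OF b]]) (use P(1) in auto)
    then have "card (b ` P) = Suc k" using P(2) by (simp add: card_image)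
    moreover have "b ` P \<subseteq> B" using bB P(1) by auto
    ultimately show ?thesis using bound by metis
  qed
  ultimately show ?thesis
    by (intro exI[of _ "card B"] exI[of _ A]) blast
qed

section \<open>The lower bound\<close>

lemma set_family_lower:
  fixes p t :: nat
  assumes p: "2 \<le> p" and pt: "p \<le> t"
  shows "\<exists>c>0. \<forall>M n. n > 0 \<longrightarrow> n \<le> M \<longrightarrow>
      real M \<le> real n powr (real t powr (1 / (real p - 1)) / (real p * (real p - 1))) \<longrightarrow>
      (\<exists>A. (\<forall>a<M. A a \<subseteq> {..<n}) \<and> c * real M * real n powr (1 - 1 / real p) \<le> (\<Sum>a<M. real (card (A a))) \<and>
           (\<forall>P\<subseteq>{..<M}. card P = p \<longrightarrow> card (\<Inter>a\<in>P. A a) < t))"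
proof -
  define k where "k = p - 1"
  have k: "k > 0" "p = Suc k" "real p - 1 = real k" using p by (auto simp: k_def of_nat_diff)
  define T where "T = real t powr (1 / real k)"
  have t0: "t > 0" using p pt by simp
  have T0: "T > 0" using t0 by (simp add: T_def)
  have Tk: "T ^ k = real t" using t0 k by (simp add: T_def powr_power)
  \<comment> \<open>\<open>D\<close> is just large enough for \<open>q ^ (D * k)\<close> to reach
    \<open>q powr (T / k)\<close>. For \<open>k = 1\<close> this means \<open>D = t\<close>, where
    the sharper bound \<open>D - 1\<close> on intersections applies.\<close>
  define D where "D = (if k = 1 then t else nat \<lceil>T / real k ^ 2\<rceil>)"
  have DT: "T / real k ^ 2 \<le> real D"
  proof (cases "k = 1")
    case True
    then show ?thesis using t0 by (simp add: D_def T_def)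
  next
    case False
    then show ?thesis by (simp add: D_def real_nat_ceiling_ge)
  qed
  have D0: "D > 0"
  proof -
    have "T / real k ^ 2 > 0" using T0 k by simp
    then show ?thesis using DT by (metis not_gr0 of_nat_0 not_less)
  qed
  \<comment> \<open>\<open>c1\<close> pays for the orbit size \<open>D\<close> and for rounding
    \<open>n\<close> up to \<open>(2 * q) ^ p\<close> in the number of sets. In \<open>c\<close>,
    the factor \<open>2 ^ k\<close> pays for the same rounding in the set sizes, and
    \<open>1 / 2 ^ p\<close> handles \<open>n < 2 ^ p\<close>.\<close>
  define c1 where "c1 = 1 / (real D * 2 powr (T / k))"
  define c where "c = min (c1 / 2 ^ k) (1 / 2 ^ p)"
  have c1: "c1 > 0" "c1 \<le> 1"
  proof -
    have "1 \<le> real D * 2 powr (T / k)"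
      using D0 T0 k by (intro mult_ge1_I) (auto intro!: ge_one_powr_ge_zero)
    then show "c1 \<le> 1" by (simp add: c1_def)
    show "c1 > 0" using D0 by (simp add: c1_def)
  qed
  have c0: "c > 0" using c1 by (simp add: c_def)
  show ?thesis
  proof (intro exI[of _ c] conjI c0 allI impI)
    fix M n :: nat
    assume n: "n > 0" and nM: "n \<le> M"
      and Mn: "real M \<le> real n powr (real t powr (1 / (real p - 1)) / (real p * (real p - 1)))"
    define x where "x = T / (real p * real k)"
    have Mx: "real M \<le> real n powr x" using Mn by (simp add: x_def T_def k)
    show "\<exists>A. (\<forall>a<M. A a \<subseteq> {..<n}) \<and> c * real M * real n powr (1 - 1 / real p) \<le> (\<Sum>a<M. real (card (A a))) \<and>
           (\<forall>P\<subseteq>{..<M}. card P = p \<longrightarrow> card (\<Inter>a\<in>P. A a) < t)"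
    proof (cases "n < 2 ^ p")
      case True
      \<comment> \<open>For such small \<open>n\<close> the required total is at most
        \<open>M\<close>, so taking \<open>{0}\<close> every time suffices; intersections have one
        element and \<open>t \<ge> 2\<close>.\<close>
      have "real n powr (1 - 1 / real p) \<le> real n powr 1"
        using n by (intro powr_mono) auto
      also have "\<dots> \<le> 2 ^ p" using True n by (simp flip: of_nat_power)
      finally have "1 / 2 ^ p * real n powr (1 - 1 / real p) \<le> 1" by simp
      moreover have "c * real n powr (1 - 1 / real p) \<le> 1 / 2 ^ p * real n powr (1 - 1 / real p)"
        by (intro mult_right_mono) (auto simp: c_def)
      ultimately have "c * real n powr (1 - 1 / real p) \<le> 1" by linarith
      then have "real M * (c * real n powr (1 - 1 / real p)) \<le> real M * 1"
        by (intro mult_left_mono) auto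
      moreover have "card (\<Inter>a\<in>P. {0::nat}) < t" if "card P = p" for P :: "nat set"
      proof -
        have "P \<noteq> {}" using that p by auto
        then show ?thesis using p pt by simp
      qed
      ultimately show ?thesis using n by (intro exI[of _ "\<lambda>_. {0}"]) (auto simp: mult_ac)
    next
      case False
      have n4: "n > 1"
      proof -
        have "(1::nat) < 2 ^ p" using p by (intro one_less_power) auto
        then show ?thesis using False by linarith
      qed
      \<comment> \<open>From \<open>n \<le> M \<le> n powr x\<close> follows
        \<open>x \<ge> 1\<close>, that is \<open>T \<ge> k * (k + 1)\<close>. This lower bound on
        \<open>t\<close> makes the intersection bound work.\<close>
      have "real n powr 1 \<le> real n powr x" using nM Mx n by simp
      then have "x \<ge> 1" using n4 by (subst (asm) powr_le_cancel_iff) auto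
      moreover have pk: "real p * real k > 0" using k by simp
      ultimately have "real p * real k \<le> T" by (simp only: x_def le_divide_eq_1_pos[OF pk])
      then have Tkk: "T \<ge> real k * (real k + 1)" using k by (simp add: algebra_simps)
      \<comment> \<open>If \<open>D \<le> 2\<close>, then
        \<open>k * D + 1 \<le> 2 * k + 1 < k * (k + 1) \<le> T\<close>. If \<open>D \<ge> 3\<close>,
        the ceiling gives \<open>k ^ 2 * (D - 1) < T\<close>, and the left side dominates
        \<open>k * D + 1\<close> as \<open>k \<ge> 2\<close>.\<close>
      have kD: "real (k * D + 1) < T" if k2: "k \<ge> 2"
      proof (cases "D \<le> 2")
        case True
        have "real k * real D \<le> real k * 2" using True by (intro mult_left_mono) auto
        then have "real (k * D + 1) \<le> 2 * real k + 1" by simp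
        also have "\<dots> < real k * (real k + 1)"
        proof -
          have "2 * real k \<le> real k * real k" using k2 by (intro mult_right_mono) auto
          moreover have "real k \<ge> 2" using k2 by simp
          moreover have "real k * (real k + 1) = real k * real k + real k"
            by (simp add: distrib_left)
          ultimately show ?thesis by linarith
        qed
        finally show ?thesis using Tkk by linarith
      next
        case False
        have "real D < T / real k ^ 2 + 1"
        proof -
          have "real D = of_int \<lceil>T / real k ^ 2\<rceil>" using T0 k2 by (simp add: D_def)
          then show ?thesis by linarith
        qed
        then have "real D - 1 < T / real k ^ 2" by simp
        then have "real k ^ 2 * (real D - 1) < T"
          using k by (subst (asm) pos_less_divide_eq) (simp_all add: mult.commute)
        moreover have "real k * real D + 1 \<le> real k ^ 2 * (real D - 1)"
        proof -
          have D3: "real D \<ge> 3" using False by simp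
          have "real k * (2 * (real D - 1)) \<le> real k * (real k * (real D - 1))"
            using k2 D3 by (intro mult_left_mono mult_right_mono) auto
          moreover have "real k * (real D - 2) \<ge> 2 * 1" using k2 D3 by (intro mult_mono) auto
          moreover have "real k ^ 2 * (real D - 1) = real k * (real k * (real D - 1))"
            "real k * (2 * (real D - 1)) = 2 * (real k * real D) - 2 * real k"
            "real k * (real D - 2) = real k * real D - 2 * real k"
            by (simp_all add: power2_eq_square algebra_simps)
          ultimately show ?thesis by linarith
        qed
        ultimately show ?thesis by simp
      qed
      have bnd: "(k * D + 1) ^ k < t" if "k \<ge> 2"
      proof -
        have "real (k * D + 1) ^ k < T ^ k" using kD[OF that] k by (intro power_strict_mono) auto
        then show ?thesis unfolding Tk by (simp only: of_nat_power[symmetric] of_nat_less_iff)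
      qed
      obtain e where e: "(2 ^ p) ^ e \<le> n" "n < (2 ^ p) ^ (e + 1)"
      proof -
        have "(2::nat) ^ 1 \<le> 2 ^ p" using p by (intro power_increasing) auto
        then show ?thesis using ex_power_ivl1[of "2 ^ p" n] n that by auto
      qed
      have e0: "e > 0" using e(2) False by (cases e) auto
      define q where "q = (2::nat) ^ e"
      have q0: "q > 0" by (simp add: q_def)
      have qn: "q ^ p \<le> n" using e(1) by (simp add: q_def power_mult[symmetric] mult.commute)
      have nq: "n < (2 * q) ^ p"
        using e(2) by (simp add: q_def power_mult[symmetric] power_mult_distrib mult.commute)
      have nq': "real n \<le> (2 * real q) powr real p"
      proof -
        have "real n \<le> real ((2 * q) ^ p)" using nq by (intro of_nat_mono less_imp_le)
        also have "\<dots> = (2 * real q) powr real p" using q0 by (simp add: powr_realpow)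
        finally show ?thesis .
      qed
      obtain a A where a: "q ^ (D * k) \<le> a * D"
        and A: "\<And>i. i < a \<Longrightarrow> A i \<subseteq> {..<q ^ Suc k}" "\<And>i. i < a \<Longrightarrow> card (A i) = q ^ k"
        and I: "\<And>P. P \<subseteq> {..<a} \<Longrightarrow> card P = Suc k \<Longrightarrow>
           card (\<Inter>i\<in>P. A i) \<le> (k * D + 1) ^ k \<and> (k = 1 \<longrightarrow> card (\<Inter>i\<in>P. A i) < D)"
        using algebraic_set_family[OF q_def e0 k(1) D0] by blast
      have It: "card (\<Inter>i\<in>P. A i) < t" if "P \<subseteq> {..<a}" "card P = Suc k" for P
      proof (cases "k = 1")
        case True
        then show ?thesis using I[OF that] by (simp add: D_def)
      next
        case False
        then show ?thesis using I[OF that] bnd k by fastforce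
      qed
      have "c1 * real M \<le> real a"
      proof -
        have "real n powr x \<le> ((2 * real q) powr real p) powr x"
          using nq' \<open>x \<ge> 1\<close> by (intro powr_mono2) auto
        also have "\<dots> = (2 * real q) powr (real p * x)"
          by (rule powr_powr)
        also have "real p * x = T / k" using k by (simp add: x_def)
        also have "(2 * real q) powr (T / k) = 2 powr (T / k) * real q powr (T / k)"
          using q0 by (simp add: powr_mult)
        also have "real q powr (T / k) \<le> real q powr (real (D * k))"
        proof (intro powr_mono)
          have "T / k = T / real k ^ 2 * k" using k by (simp add: power2_eq_square)
          also have "\<dots> \<le> real D * k" using DT by (intro mult_right_mono) auto
          finally show "T / k \<le> real (D * k)" by simp
        qed (use q0 in auto)
        also have "real q powr (real (D * k)) = real (q ^ (D * k))"
          using q0 by (subst powr_realpow) simp_all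
        also have "\<dots> \<le> real a * real D" using a by (metis of_nat_mono of_nat_mult)
        finally have "real M \<le> 2 powr (T / k) * (real a * real D)" using Mx by simp
        then show ?thesis using D0 by (simp add: c1_def field_simps)
      qed
      \<comment> \<open>There may be fewer than \<open>M\<close> algebraic sets. The remaining
        indices get the empty set, which cannot harm intersections, and \<open>c1 \<le> 1\<close>
        ensures that at least \<open>c1 * M\<close> sets are filled.\<close>
      define L where "L = min a M"
      have L: "c1 * real M \<le> real L"
        using \<open>c1 * real M \<le> real a\<close> mult_right_mono[OF c1(2), of "real M"] by (simp add: L_def min_def)
      define B where "B i = (if i < a then A i else {})" for i
      have "B i \<subseteq> {..<n}" for i
      proof (cases "i < a")
        case True
        have "A i \<subseteq> {..<q ^ p}" using A(1)[OF True] k(2) by simp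
        also have "\<dots> \<subseteq> {..<n}" using qn by simp
        finally show ?thesis using True by (simp add: B_def)
      qed (simp add: B_def)
      moreover have "card (\<Inter>i\<in>P. B i) < t" if "card P = p" for P
      proof (cases "P \<subseteq> {..<a}")
        case True
        then have "(\<Inter>i\<in>P. B i) = (\<Inter>i\<in>P. A i)" by (auto simp: B_def)
        then show ?thesis using It[OF True] that k by simp
      next
        case False
        then have "(\<Inter>i\<in>P. B i) = {}" by (auto simp: B_def)
        then show ?thesis using t0 by simp
      qed
      moreover have "c * real M * real n powr (1 - 1 / real p) \<le> (\<Sum>i<M. real (card (B i)))"
      proof -
        have "real n powr (1 - 1 / real p) \<le> ((2 * real q) powr real p) powr (1 - 1 / real p)"
          using nq' p by (intro powr_mono2) auto
        also have "\<dots> = (2 * real q) powr (real p * (1 - 1 / real p))"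
          by (rule powr_powr)
        also have "real p * (1 - 1 / real p) = real k" using k by (simp add: field_simps)
        also have "(2 * real q) powr real k = 2 ^ k * real q ^ k"
          using q0 by (simp add: powr_realpow power_mult_distrib)
        finally have nk: "real n powr (1 - 1 / real p) \<le> 2 ^ k * real q ^ k" .
        have "c * real M * real n powr (1 - 1 / real p) \<le> (c1 / 2 ^ k) * real M * (2 ^ k * real q ^ k)"
          using nk c1 by (intro mult_mono) (auto simp: c_def)
        also have "\<dots> = c1 * real M * real q ^ k" by simp
        also have "\<dots> \<le> real L * real q ^ k" using L by (intro mult_right_mono) auto
        also have "\<dots> = (\<Sum>i<L. real (card (B i)))" using A(2) by (simp add: B_def L_def)
        also have "\<dots> \<le> (\<Sum>i<M. real (card (B i)))" by (intro sum_mono2) (auto simp: L_def)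
        finally show ?thesis .
      qed
      ultimately show ?thesis by blast
    qed
  qed
qed

section \<open>From set families to hypergraphs\<close>

text \<open>The tuples of the first \<open>r - 1\<close> parts are numbered by
  \<open>\<beta>\<close>, and the tuple \<open>g\<close> is joined to the elements of
  \<open>A (\<beta> g)\<close>. An ordered copy of the forbidden hypergraph would yield
  \<open>\<Prod>i\<in>J. s i\<close> tuples whose sets share \<open>t\<close> elements.\<close>

lemma zarankiewicz_ge_set_family:
  fixes r t n M :: nat and s m :: "nat \<Rightarrow> nat" and A :: "nat \<Rightarrow> nat set"
  assumes r: "r \<ge> 2"
    and s: "\<And>i. i \<in> {1..r - 1} \<Longrightarrow> s i > 0"
    and M: "M = (\<Prod>i = 1..r - 1. m i)"
    and A: "\<And>a. a < M \<Longrightarrow> A a \<subseteq> {..<n}"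
    and I: "\<And>P. P \<subseteq> {..<M} \<Longrightarrow> card P = (\<Prod>i = 1..r - 1. s i) \<Longrightarrow> card (\<Inter>a\<in>P. A a) < t"
  shows "(\<Sum>a<M. card (A a)) \<le> zarankiewicz r (m(r := n)) (s(r := t))"
proof -
  define J where "J = {1..r - 1}"
  have Jr: "{1..r} = insert r J" "r \<notin> J" "finite J" "card J = r - 1" using r by (auto simp: J_def)
  define G where "G = PiE J (\<lambda>i. {..<m i})"
  have finG: "finite G" unfolding G_def using Jr by (intro finite_PiE) auto
  have "card G = M" unfolding G_def M J_def[symmetric] using Jr by (simp add: card_PiE)
  then obtain \<beta> where \<beta>: "bij_betw \<beta> G {0..<M}" using ex_bij_betw_finite_nat[OF finG] by auto
  have \<beta>M: "\<beta> g < M" if "g \<in> G" for g using bij_betwE[OF \<beta>] that by auto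
  \<comment> \<open>Vertices carry the index of their part, which makes the parts disjoint and lets
    an edge determine its tuple.\<close>
  define V where "V i = Pair i ` {..<(m(r := n)) i}" for i :: nat
  define edge where "edge g b = insert (r, b) ((\<lambda>i. (i, g i)) ` J)" for g :: "nat \<Rightarrow> nat" and b :: nat
  define E where "E = (SIGMA g:G. A (\<beta> g))"
  define H where "H = ((\<Union>i\<in>{1..r}. V i), (\<lambda>(g, b). edge g b) ` E)"
  have edge_eq: "b = b' \<and> g = g'" if "edge g b = edge g' b'" "g \<in> extensional J" "g' \<in> extensional J" for g g' b b'
  proof
    have "(r, b) \<in> edge g' b'" using that(1) by (auto simp: edge_def)
    then show "b = b'" using Jr(2) by (auto simp: edge_def)
    show "g = g'"
    proof (rule extensionalityI[OF that(2,3)])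
      fix i assume i: "i \<in> J"
      then have "(i, g i) \<in> edge g' b'" using that(1) by (auto simp: edge_def)
      then show "g i = g' i" using Jr(2) i by (auto simp: edge_def)
    qed
  qed
  have ED: "(\<forall>i\<in>J. g i < m i) \<and> g \<in> extensional J \<and> b < n" if "(g, b) \<in> E" for g b
    using that A[OF \<beta>M, of g] by (auto simp: E_def G_def PiE_iff)
  have inj: "inj_on (\<lambda>(g, b). edge g b) E"
    using edge_eq ED by (auto simp: inj_on_def)
  have cardV: "card (V i) = (m(r := n)) i" for i
    unfolding V_def by (subst card_image) (auto simp: inj_on_def)
  have edgeV: "edge g b \<inter> V i = {(i, (g(r := b)) i)}" if "(g, b) \<in> E" "i \<in> insert r J" for g b i
    using ED[OF that(1)] that(2) Jr(2) by (auto simp: edge_def V_def)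
  have "rgraph r H"
    unfolding rgraph_def
  proof (intro conjI ballI)
    show "finite (verts H)" by (auto simp: H_def V_def)
    fix e assume "e \<in> edges H"
    then obtain g b where gb: "(g, b) \<in> E" "e = edge g b" by (auto simp: H_def)
    show "e \<subseteq> verts H"
      unfolding H_def Jr(1) using ED[OF gb(1)] Jr(2) by (auto simp: gb edge_def V_def)
    have "card ((\<lambda>i. (i, g i)) ` J) = r - 1"
      using Jr by (subst card_image) (auto simp: inj_on_def)
    moreover have "(r, b) \<notin> (\<lambda>i. (i, g i)) ` J" using Jr(2) by auto
    ultimately show "card e = r" using Jr r by (simp add: gb edge_def)
  qed
  moreover have "rpartite r V H"
    unfolding rpartite_def
  proof (intro conjI ballI)
    show "verts H = (\<Union>i\<in>{1..r}. V i)" by (simp add: H_def)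
    show "disjoint_family_on V {1..r}" by (auto simp: disjoint_family_on_def V_def)
    fix e i assume "e \<in> edges H" "i \<in> {1..r}"
    then show "card (e \<inter> V i) = 1"
      unfolding Jr(1) by (auto simp: H_def edgeV)
  qed
  moreover have "\<not> contains_ordered_K r (s(r := t)) V H"
  proof
    assume "contains_ordered_K r (s(r := t)) V H"
    then obtain S where S: "\<And>i. i \<in> insert r J \<Longrightarrow> S i \<subseteq> V i \<and> card (S i) = (s(r := t)) i"
      and SE: "\<And>v. \<forall>i\<in>insert r J. v i \<in> S i \<Longrightarrow> v ` insert r J \<in> edges H"
      unfolding contains_ordered_K_def Jr(1) by blast
    define T where "T i = snd ` S i" for i
    have T: "T i \<subseteq> {..<(m(r := n)) i} \<and> card (T i) = (s(r := t)) i" if "i \<in> insert r J" for i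
    proof -
      have "inj_on snd (S i)" using S[OF that] by (auto simp: inj_on_def V_def)
      then show ?thesis using S[OF that] by (auto simp: T_def V_def card_image)
    qed
    have TS: "(i, j) \<in> S i" if "i \<in> insert r J" "j \<in> T i" for i j
      using S[OF that(1)] that(2) by (auto simp: T_def V_def)
    define Q where "Q = PiE J T"
    have QG: "Q \<subseteq> G" unfolding Q_def G_def
    proof (rule PiE_mono)
      fix i assume i: "i \<in> J"
      then have "i \<noteq> r" using Jr(2) by blast
      then show "T i \<subseteq> {..<m i}" using T[of i] i by simp
    qed
    have "card Q = (\<Prod>i\<in>J. s i)"
      unfolding Q_def card_PiE[OF Jr(3)]
    proof (rule prod.cong[OF refl])
      fix i assume i: "i \<in> J"
      then have "i \<noteq> r" using Jr(2) by blast
      then show "card (T i) = s i" using T[of i] i by simp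
    qed
    moreover have "inj_on \<beta> Q" using bij_betw_imp_inj_on[OF \<beta>] QG by (rule inj_on_subset)
    ultimately have cQ: "card (\<beta> ` Q) = (\<Prod>i\<in>J. s i)" by (simp add: card_image)
    have QM: "\<beta> ` Q \<subseteq> {..<M}" using QG \<beta>M by auto
    have "(\<Prod>i\<in>J. s i) > 0" using s by (intro prod_pos) (auto simp: J_def)
    \<comment> \<open>Positivity of the \<open>s i\<close> makes the family of selected tuples
      nonempty, so the intersection below is finite.\<close>
    then obtain g0 where g0: "g0 \<in> Q" using cQ by fastforce
    have "T r \<subseteq> (\<Inter>a\<in>\<beta> ` Q. A a)"
    proof (intro subsetI INT_I)
      fix b a assume b: "b \<in> T r" and "a \<in> \<beta> ` Q"
      then obtain g where g: "g \<in> Q" "a = \<beta> g" by auto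
      have "(\<lambda>i. (i, (g(r := b)) i)) ` insert r J \<in> edges H"
      proof (rule SE, rule ballI)
        fix i assume i: "i \<in> insert r J"
        show "(i, (g(r := b)) i) \<in> S i"
          using g b i by (intro TS) (auto simp: Q_def PiE_iff)
      qed
      moreover have "(\<lambda>i. (i, (g(r := b)) i)) ` insert r J = edge g b"
      proof -
        have "(\<lambda>i. (i, (g(r := b)) i)) ` J = (\<lambda>i. (i, g i)) ` J"
          using Jr(2) by (intro image_cong) auto
        then show ?thesis by (simp add: edge_def)
      qed
      ultimately obtain g' b' where gb': "(g', b') \<in> E" "edge g b = edge g' b'" by (auto simp: H_def)
      have "b = b' \<and> g = g'"
        using gb' ED[OF gb'(1)] g by (intro edge_eq) (auto simp: Q_def PiE_iff)
      then show "b \<in> A a" using gb'(1) g by (auto simp: E_def)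
    qed
    moreover have "finite (\<Inter>a\<in>\<beta> ` Q. A a)"
      using A[of "\<beta> g0"] g0 QG \<beta>M by (meson INT_lower finite_lessThan finite_subset image_eqI subsetD)
    ultimately have "card (T r) \<le> card (\<Inter>a\<in>\<beta> ` Q. A a)" by (rule card_mono[rotated])
    also have "\<dots> < t" using I[OF QM] cQ by (simp add: J_def)
    finally show False using T[of r] by simp
  qed
  ultimately have "zarankiewicz_admissible r (m(r := n)) (s(r := t)) V H"
    using cardV by (simp add: zarankiewicz_admissible_def)
  then have "card (edges H) \<le> zarankiewicz r (m(r := n)) (s(r := t))"
    by (rule card_edges_le_zarankiewicz)
  moreover have "card (edges H) = (\<Sum>a<M. card (A a))"
  proof -
    have "finite (A (\<beta> g))" if "g \<in> G" for g
      using A[OF \<beta>M[OF that]] by (rule finite_subset) simp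
    then have "card (edges H) = (\<Sum>g\<in>G. card (A (\<beta> g)))"
      unfolding H_def using inj finG by (simp add: card_image E_def)
    also have "\<dots> = (\<Sum>a\<in>{0..<M}. card (A a))" using \<beta> by (rule sum.reindex_bij_betw)
    finally show ?thesis by (simp add: atLeast0LessThan)
  qed
  ultimately show ?thesis by simp
qed

theorem corollary1p4:
  fixes r t p :: nat and s :: "nat \<Rightarrow> nat"
  assumes "r \<ge> 2"
    and "\<And>i. i \<in> {1..r - 1} \<Longrightarrow> s i > 0"
    and "t > 0"
    and "p = (\<Prod>i = 1..r - 1. s i)"
    and "2 \<le> p" and "p \<le> t"
  shows "\<exists>c C :: real. c > 0 \<and> C > 0 \<and>
    (\<forall>(m :: nat \<Rightarrow> nat) (n :: nat).
       n > 0 \<longrightarrow>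
       (\<forall>i\<in>{1..r - 1}. m i > 0 \<and> m i \<ge> n) \<longrightarrow>
       real (\<Prod>i = 1..r - 1. m i)
         \<le> real n powr (real t powr (1 / (real p - 1)) / (real p * (real p - 1))) \<longrightarrow>
       c * real (\<Prod>i = 1..r - 1. m i) * real n powr (1 - 1 / real p)
         \<le> real (zarankiewicz r (m(r := n)) (s(r := t))) \<and>
       real (zarankiewicz r (m(r := n)) (s(r := t)))
         \<le> C * real (\<Prod>i = 1..r - 1. m i) * real n powr (1 - 1 / real p))"
proof -
  define M where "M m = (\<Prod>i = 1..r - 1. m i)" for m :: "nat \<Rightarrow> nat"
  obtain c where c: "c > 0" and low: "\<And>M n. n > 0 \<Longrightarrow> n \<le> M \<Longrightarrow>
      real M \<le> real n powr (real t powr (1 / (real p - 1)) / (real p * (real p - 1))) \<Longrightarrow>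
      \<exists>A. (\<forall>a<M. A a \<subseteq> {..<n}) \<and> c * real M * real n powr (1 - 1 / real p) \<le> (\<Sum>a<M. real (card (A a))) \<and>
           (\<forall>P\<subseteq>{..<M}. card P = p \<longrightarrow> card (\<Inter>a\<in>P. A a) < t)"
    using set_family_lower[OF assms(5,6)] by metis
  define C where "C = real t + (\<Sum>i = 1..r - 1. real (s i) ^ 2)"
  have C: "C > 0" unfolding C_def using assms(3) by (intro add_pos_nonneg sum_nonneg) auto
  have lower: "c * real (M m) * real n powr (1 - 1 / real p)
        \<le> real (zarankiewicz r (m(r := n)) (s(r := t)))"
    if n: "n > 0" and m: "\<forall>i\<in>{1..r - 1}. m i > 0 \<and> m i \<ge> n"
      and Mn: "real (M m) \<le> real n powr (real t powr (1 / (real p - 1)) / (real p * (real p - 1)))"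
    for m n
  proof -
    \<comment> \<open>\<open>n \<le> M m\<close> holds because already the factor \<open>m 1\<close>
      is at least \<open>n\<close> and the other factors are positive.\<close>
    have "1 \<in> {1..r - 1}" using assms(1) by simp
    then have "M m = m 1 * (\<Prod>i\<in>{1..r - 1} - {1}. m i)" unfolding M_def by (intro prod.remove) auto
    moreover have "(\<Prod>i\<in>{1..r - 1} - {1}. m i) > 0" using m by (intro prod_pos) auto
    then have "m 1 * 1 \<le> m 1 * (\<Prod>i\<in>{1..r - 1} - {1}. m i)" by (intro mult_le_mono2) (simp only: One_nat_def Suc_le_eq)
    ultimately have "m 1 \<le> M m" by simp
    then have "n \<le> M m" using m \<open>1 \<in> {1..r - 1}\<close> by (meson order_trans)
    from low[OF n this Mn] obtain A where A: "\<And>a. a < M m \<Longrightarrow> A a \<subseteq> {..<n}"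
      "c * real (M m) * real n powr (1 - 1 / real p) \<le> (\<Sum>a<M m. real (card (A a)))"
      "\<And>P. P \<subseteq> {..<M m} \<Longrightarrow> card P = p \<Longrightarrow> card (\<Inter>a\<in>P. A a) < t" by blast
    have "(\<Sum>a<M m. card (A a)) \<le> zarankiewicz r (m(r := n)) (s(r := t))"
      using assms A by (intro zarankiewicz_ge_set_family) (auto simp: M_def)
    then have "(\<Sum>a<M m. real (card (A a))) \<le> real (zarankiewicz r (m(r := n)) (s(r := t)))"
      unfolding of_nat_sum[symmetric] by (rule of_nat_mono)
    then show ?thesis using A(2) by linarith
  qed
  show ?thesis
  proof (rule exI[of _ c], rule exI[of _ C], intro conjI allI impI c C)
    fix m :: "nat \<Rightarrow> nat" and n :: nat
    assume n: "n > 0" and m: "\<forall>i\<in>{1..r - 1}. m i > 0 \<and> m i \<ge> n"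
      and Mn: "real (\<Prod>i = 1..r - 1. m i)
        \<le> real n powr (real t powr (1 / (real p - 1)) / (real p * (real p - 1)))"
    show "c * real (\<Prod>i = 1..r - 1. m i) * real n powr (1 - 1 / real p)
        \<le> real (zarankiewicz r (m(r := n)) (s(r := t)))"
      using lower[OF n m] Mn unfolding M_def by simp
    show "real (zarankiewicz r (m(r := n)) (s(r := t)))
        \<le> C * real (\<Prod>i = 1..r - 1. m i) * real n powr (1 - 1 / real p)"
      unfolding C_def by (rule zarankiewicz_upper) (use assms n m in auto)
  qed
qed

end
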